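(* Let $m,n$ be non-negative integers, let $\Gamma\le S_m\times S_n\times S_2^n$ be a fixed group, and let $H$ be a fixed $(m,n)$-mixed graph that is $\Gamma$-switchable $2$-colourable. Then the decision problem $\Gamma$-Hom-$H$ is solvable in polynomial time.
   Context: All graphs and groups are finite. A mixed graph is a triple $G=(V(G),E(G),A(G))$ with a vertex set $V(G)$, a set $E(G)$ of edges (unordered pairs of vertices) and a set $A(G)$ of arcs (ordered pairs of vertices); it is loop-free, and each pair of vertices $u,v$ is joined by at most one edge or one arc, but not both (in particular not by two opposite arcs). We write $[m]=\{1,\dots,m\}$. An $(m,n)$-mixed graph is a mixed graph together with functions $c:E(G)\to[m]$ and $d:A(G)\to[n]$ assigning colours to edges and to arcs (the edge colours and arc colours are disjoint sets). A homomorphism $G\to H$ of $(m,n)$-mixed graphs is a function $h:V(G)\to V(H)$ such that if $uv$ is an edge of colour $i$ in $G$ then $h(u)h(v)$ is an edge of colour $i$ in $H$, and if $uv$ is an arc (from $u$ to $v$) of colour $j$ in $G$ then $h(u)h(v)$ is an arc (from $h(u)$ to $h(v)$) of colour $j$ in $H$. Elements of $\Gamma\le S_m\times S_n\times S_2^n$ are tuples $\pi=(\alpha,\beta,\gamma_1,\dots,\gamma_n)$, where $\alpha$ acts on edge colours, $\beta$ acts on arc colours, and $\gamma_i$ acts on the direction of arcs of colour $i$ (either preserving or reversing it). Switching $G$ at a vertex $v$ with respect to $\pi$ gives the $(m,n)$-mixed graph $G^{(v,\pi)}$ in which each edge $vw$ of colour $i$ is replaced by an edge $vw$ of colour $\alpha(i)$,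 and each arc $a$ of colour $i$ incident with $v$ is replaced by an arc of colour $\beta(i)$ with orientation $\gamma_i(a)$; everything else is unchanged. For a sequence $\Sigma=(v_1,\pi_1)\cdots(v_r,\pi_r)$ of elements of $V(G)\times\Gamma$, $G^\Sigma$ is the result of performing these switches in order. A $\Gamma$-switchable homomorphism of $G$ to $H$, denoted $G\to_\Gamma H$, is a sequence of switches $\Sigma$ together with a homomorphism $G^\Sigma\to H$. An $(m,n)$-mixed graph $G$ is $\Gamma$-switchable $2$-colourable if there is an $(m,n)$-mixed graph $H'$ with $2$ vertices such that $G\to_\Gamma H'$. The problem $\Gamma$-Hom-$H$ (with $H$ and $\Gamma$ fixed) is: Input: an $(m,n)$-mixed graph $G$. Question: does $G$ admit a $\Gamma$-switchable homomorphism to $H$? *)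

theory Defs
  imports
    "HOL-Algebra.Sym_Groups"
    "HOL-Algebra.Product_Groups"
    "HOL-Computational_Algebra.Polynomial"
begin

section \<open>Mixed graphs and homomorphisms\<close>

text \<open>The values of \<open>ecol\<close> outside \<open>edges\<close> and of \<open>acol\<close> outside \<open>arcs\<close> are irrelevant. The edge
  colours and the arc colours are disjoint because a colour is always read together with its kind.\<close>

record 'v mgraph =
  verts :: "'v set"
  edges :: "'v set set"
  arcs  :: "('v \<times> 'v) set"
  ecol  :: "'v set \<Rightarrow> nat"
  acol  :: "'v \<times> 'v \<Rightarrow> nat"

definition mixed_graph :: "nat \<Rightarrow> nat \<Rightarrow> 'v mgraph \<Rightarrow> bool" where
  "mixed_graph m n G \<longleftrightarrow>
     finite (verts G) \<and>
     edges G \<subseteq> {{u, v} | u v. u \<in> verts G \<and> v \<in> verts G \<and> u \<noteq> v} \<and>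
     arcs G \<subseteq> {(u, v). u \<in> verts G \<and> v \<in> verts G \<and> u \<noteq> v} \<and>
     (\<forall>u v. (u, v) \<in> arcs G \<longrightarrow> {u, v} \<notin> edges G \<and> (v, u) \<notin> arcs G) \<and>
     ecol G \<in> edges G \<rightarrow> {1..m} \<and>
     acol G \<in> arcs G \<rightarrow> {1..n}"

definition mgraph_hom :: "'v mgraph \<Rightarrow> 'w mgraph \<Rightarrow> ('v \<Rightarrow> 'w) \<Rightarrow> bool" where
  "mgraph_hom G H h \<longleftrightarrow>
     h \<in> verts G \<rightarrow> verts H \<and>
     (\<forall>u v. {u, v} \<in> edges G \<longrightarrow> {h u, h v} \<in> edges H \<and> ecol H {h u, h v} = ecol G {u, v}) \<and>
     (\<forall>u v. (u, v) \<in> arcs G \<longrightarrow> (h u, h v) \<in> arcs H \<and> acol H (h u, h v) = acol G (u, v))"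


section \<open>Switching\<close>

type_synonym switch = "(nat \<Rightarrow> nat) \<times> (nat \<Rightarrow> nat) \<times> (nat \<Rightarrow> nat \<Rightarrow> nat)"

definition switch_group :: "nat \<Rightarrow> nat \<Rightarrow> switch monoid" where
  "switch_group m n =
     sym_group m \<times>\<times> sym_group n \<times>\<times> product_group {1..n} (\<lambda>_. sym_group 2)"

text \<open>A permutation of \<open>{1, 2}\<close> acts on an arc by permuting its two positions (tail and head).\<close>

definition orient :: "(nat \<Rightarrow> nat) \<Rightarrow> 'v \<times> 'v \<Rightarrow> 'v \<times> 'v" where
  "orient g a = (if g 1 = 1 then a else (snd a, fst a))"

definition incident :: "'v \<Rightarrow> 'v \<times> 'v \<Rightarrow> bool" where
  "incident v a \<longleftrightarrow> v = fst a \<or> v = snd a"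

definition switch_arc :: "'v mgraph \<Rightarrow> 'v \<Rightarrow> switch \<Rightarrow> 'v \<times> 'v \<Rightarrow> 'v \<times> 'v" where
  "switch_arc G v = (\<lambda>(\<alpha>, \<beta>, \<gamma>) a. if incident v a then orient (\<gamma> (acol G a)) a else a)"

text \<open>The colour of an arc \<open>b\<close> of the switched graph is computed from the unique arc \<open>a\<close> of \<open>G\<close> which is
  replaced by \<open>b\<close>; uniqueness holds since \<open>G\<close> has no two opposite arcs.\<close>

definition switch_at :: "'v mgraph \<Rightarrow> 'v \<times> switch \<Rightarrow> 'v mgraph" where
  "switch_at G = (\<lambda>(v, \<alpha>, \<beta>, \<gamma>).
     \<lparr> verts = verts G,
       edges = edges G,
       arcs = switch_arc G v (\<alpha>, \<beta>, \<gamma>) ` arcs G,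
       ecol = (\<lambda>e. if v \<in> e then \<alpha> (ecol G e) else ecol G e),
       acol = (\<lambda>b. let a = the_inv_into (arcs G) (switch_arc G v (\<alpha>, \<beta>, \<gamma>)) b
                   in if incident v a then \<beta> (acol G a) else acol G a) \<rparr>)"

definition switch_seq :: "'v mgraph \<Rightarrow> ('v \<times> switch) list \<Rightarrow> 'v mgraph" where
  "switch_seq = foldl switch_at"

definition switchable_hom :: "switch set \<Rightarrow> 'v mgraph \<Rightarrow> 'w mgraph \<Rightarrow> bool" where
  "switchable_hom \<Gamma> G H \<longleftrightarrow>
     (\<exists>\<Sigma> h. \<Sigma> \<in> lists (verts G \<times> \<Gamma>) \<and> mgraph_hom (switch_seq G \<Sigma>) H h)"

definition switchable_2_colourable ::
  "nat \<Rightarrow> nat \<Rightarrow> switch set \<Rightarrow> 'v mgraph \<Rightarrow> bool" where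
  "switchable_2_colourable m n \<Gamma> G \<longleftrightarrow>
     (\<exists>H' :: nat mgraph. mixed_graph m n H' \<and> card (verts H') = 2 \<and> switchable_hom \<Gamma> G H')"


section \<open>Polynomial time\<close>

text \<open>Deterministic multi-tape Turing machines. Tapes are infinite in both directions, and the tape
  alphabet consists of the blank, the input letters and finitely many further work symbols.\<close>

datatype 'a symbol = Blank | Letter 'a | Work nat

datatype move = MoveLeft | MoveNone | MoveRight

record 'a tm =
  tm_tapes   :: nat
  tm_states  :: "nat set"
  tm_symbols :: "'a symbol set"
  tm_start   :: nat
  tm_accept  :: nat
  tm_reject  :: nat
  tm_delta   :: "nat \<Rightarrow> 'a symbol list \<Rightarrow> nat \<times> ('a symbol \<times> move) list"

definition turing_machine :: "'a set \<Rightarrow> 'a tm \<Rightarrow> bool" where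
  "turing_machine A M \<longleftrightarrow>
     tm_tapes M \<ge> 1 \<and>
     finite (tm_states M) \<and> {tm_start M, tm_accept M, tm_reject M} \<subseteq> tm_states M \<and>
     tm_accept M \<noteq> tm_reject M \<and>
     finite (tm_symbols M) \<and> insert Blank (Letter ` A) \<subseteq> tm_symbols M \<and>
     (\<forall>q \<in> tm_states M. \<forall>ss \<in> lists (tm_symbols M). length ss = tm_tapes M \<longrightarrow>
        fst (tm_delta M q ss) \<in> tm_states M \<and>
        snd (tm_delta M q ss) \<in> lists (tm_symbols M \<times> UNIV) \<and>
        length (snd (tm_delta M q ss)) = tm_tapes M)"

text \<open>A tape is given by its contents and the position of its head.\<close>

type_synonym 'a tape = "(int \<Rightarrow> 'a symbol) \<times> int"

type_synonym 'a config = "nat \<times> 'a tape list"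

fun move_head :: "move \<Rightarrow> int \<Rightarrow> int" where
  "move_head MoveLeft i = i - 1"
| "move_head MoveNone i = i"
| "move_head MoveRight i = i + 1"

fun tape_read :: "'a tape \<Rightarrow> 'a symbol" where
  "tape_read (t, i) = t i"

fun tape_act :: "'a symbol \<times> move \<Rightarrow> 'a tape \<Rightarrow> 'a tape" where
  "tape_act (s, d) (t, i) = (t(i := s), move_head d i)"

definition tm_step :: "'a tm \<Rightarrow> 'a config \<Rightarrow> 'a config" where
  "tm_step M = (\<lambda>(q, ts).
     if q \<in> {tm_accept M, tm_reject M} then (q, ts)
     else let (q', acts) = tm_delta M q (map tape_read ts)
          in (q', map2 tape_act acts ts))"

definition input_tape :: "'a list \<Rightarrow> 'a tape" where
  "input_tape w =
     ((\<lambda>i. if 0 \<le> i \<and> i < int (length w) then Letter (w ! nat i) else Blank), 0)"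

definition blank_tape :: "'a tape" where
  "blank_tape = ((\<lambda>_. Blank), 0)"

definition tm_init :: "'a tm \<Rightarrow> 'a list \<Rightarrow> 'a config" where
  "tm_init M w = (tm_start M, input_tape w # replicate (tm_tapes M - 1) blank_tape)"

definition tm_state_after :: "'a tm \<Rightarrow> 'a list \<Rightarrow> nat \<Rightarrow> nat" where
  "tm_state_after M w t = fst ((tm_step M ^^ t) (tm_init M w))"

text \<open>Since a machine remains in its accepting or rejecting state, being in such a state after \<open>t\<close>
  steps means having halted within \<open>t\<close> steps.\<close>

definition polynomial_time :: "'a set \<Rightarrow> 'a list set \<Rightarrow> bool" where
  "polynomial_time A L \<longleftrightarrow>
     L \<subseteq> lists A \<and>
     (\<exists>(M :: 'a tm) (p :: nat poly). turing_machine A M \<and>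
        (\<forall>w \<in> lists A. tm_state_after M w (poly p (length w)) =
                         (if w \<in> L then tm_accept M else tm_reject M)))"


section \<open>The decision problem\<close>

text \<open>A mixed graph with vertex set \<open>{0, \<dots>, N - 1}\<close> is presented as its lower triangular adjacency
  matrix. Row \<open>v\<close> consists of one letter for each \<open>u < v\<close>, describing how \<open>u\<close> and \<open>v\<close> are joined,
  and is closed by \<open>EndRow\<close>. As \<open>m\<close> and \<open>n\<close> are fixed, the input alphabet is finite.\<close>

datatype letter =
    EndRow
  | NotAdj
  | EdgeCol nat
  | ArcUp nat    \<comment> \<open>arc from the smaller to the larger vertex\<close>
  | ArcDown nat  \<comment> \<open>arc from the larger to the smaller vertex\<close>

definition graph_alphabet :: "nat \<Rightarrow> nat \<Rightarrow> letter set" where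
  "graph_alphabet m n =
     {EndRow, NotAdj} \<union> EdgeCol ` {1..m} \<union> ArcUp ` {1..n} \<union> ArcDown ` {1..n}"

definition adj_letter :: "nat mgraph \<Rightarrow> nat \<Rightarrow> nat \<Rightarrow> letter" where
  "adj_letter G u v =
     (if {u, v} \<in> edges G then EdgeCol (ecol G {u, v})
      else if (u, v) \<in> arcs G then ArcUp (acol G (u, v))
      else if (v, u) \<in> arcs G then ArcDown (acol G (v, u))
      else NotAdj)"

definition encode_graph :: "nat mgraph \<Rightarrow> letter list" where
  "encode_graph G =
     concat (map (\<lambda>v. map (\<lambda>u. adj_letter G u v) [0..<v] @ [EndRow]) [0..<card (verts G)])"

definition switchable_hom_problem ::
  "nat \<Rightarrow> nat \<Rightarrow> switch set \<Rightarrow> 'w mgraph \<Rightarrow> letter list set" where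
  "switchable_hom_problem m n \<Gamma> H =
     {encode_graph G | G. mixed_graph m n G \<and> verts G = {..<card (verts G)} \<and>
                          switchable_hom \<Gamma> G H}"

end

theory Submission
  imports Defs "HOL-Library.Countable_Set"
begin

text \<open>Switching at a vertex acts on the letters of the incident pairs by a group \<open>T\<close> of permutations.
  For an edge \<open>uv\<close>, a commutator of a switch at \<open>u\<close> and a switch at \<open>v\<close> changes the letter of \<open>uv\<close> and
  of no other pair, so only the orbits of the commutator subgroup \<open>[T, T]\<close> matter and switching becomes
  abelian on them. If \<open>H\<close> has an adjacent pair with letter \<open>x\<close>, it follows that \<open>G\<close> maps to \<open>H\<close> iff there
  are a bipartition of \<open>G\<close> and elements \<open>s u\<close> of \<open>T\<close> such that the letter of each edge \<open>uv\<close> is equivalent to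
  \<open>s u (s v x)\<close>. This is a constraint satisfaction problem over a finite domain whose nontrivial
  constraints are partial bijections.

  Such a problem is solved by eliminating the vertices one at a time, the last one first: the
  constraints between the eliminated vertex and two other vertices are composed, and the result is
  intersected with the constraint between these two. On the lower triangular adjacency matrix one
  elimination is a sequence of parallel sweeps over two tapes: the last row is moved to a second tape
  and combined with each of the remaining rows.\<close>

section \<open>Two-tape machines on zippers\<close>

text \<open>Why one letter of \<open>H\<close> can stand for \<open>H\<close>: a switch of
  \<open>H\<close> onto two vertices writes each of its letters, up to equivalence, as
  \<open>s u (s v y)\<close> with \<open>y\<close> the letter of the target, and \<open>y\<close>
  can be exchanged for any letter \<open>x\<close> that occurs in \<open>H\<close>. Hence mapping to
  \<open>H\<close> amounts to mapping to a single adjacent pair of \<open>H\<close>. An edgeless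
  \<open>H\<close> has no such letter and gets a separate, trivial constraint problem.

  Why elimination loses nothing: a constraint between the eliminated vertex and a neighbour, if not
  full, lets the value at the neighbour determine the value at the vertex. So conditions on pairs of
  neighbours already ensure one value that suits all of them, which fails for arbitrary binary
  constraints.

  Why a fixed alphabet suffices: compositions and intersections of partial bijections are partial
  bijections, and full constraints are kept out of compositions. Every matrix entry thus ranges over
  a finite set that depends on \<open>m\<close>, \<open>n\<close>, \<Gamma> and \<open>H\<close>
  only.\<close>

type_synonym 'a zipper = "'a symbol list \<times> 'a symbol list"

text \<open>Trailing blanks are never stored, so that equal tapes are represented by equal lists.\<close>

fun bcons :: "'a symbol \<Rightarrow> 'a symbol list \<Rightarrow> 'a symbol list" (infixr "##" 65) where
  "s ## [] = (if s = Blank then [] else [s])"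
| "s ## x # xs = s # x # xs"

fun bhd :: "'a symbol list \<Rightarrow> 'a symbol" where
  "bhd [] = Blank"
| "bhd (x # xs) = x"

text \<open>In a zipper \<open>(l, r)\<close> the head stands on the first entry of \<open>l\<close>, and \<open>l\<close> is read leftwards.\<close>

fun zact :: "'a symbol \<times> move \<Rightarrow> 'a zipper \<Rightarrow> 'a zipper" where
  "zact (s, MoveLeft) (l, r) = (tl l, s ## r)"
| "zact (s, MoveNone) (l, r) = (s ## tl l, r)"
| "zact (s, MoveRight) (l, r) = (bhd r ## s ## tl l, tl r)"

definition represents :: "'a tape \<Rightarrow> 'a zipper \<Rightarrow> bool" where
  "represents T z \<longleftrightarrow> (\<forall>k. fst T (snd T - int k) = nth_default Blank (fst z) k \<and>
                           fst T (snd T + 1 + int k) = nth_default Blank (snd z) k)"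

lemma bcons_nonblank [simp]: "s \<noteq> Blank \<Longrightarrow> s ## xs = s # xs"
  by (cases xs) auto

lemma nth_default_bcons: "nth_default Blank (s ## xs) k = nth_default Blank (s # xs) k"
  by (cases xs; cases k) (auto simp: nth_default_Cons split: nat.splits)

lemma nth_default_tl: "nth_default d (tl xs) k = nth_default d xs (Suc k)"
  by (cases xs) auto

lemma bhd_nth_default: "bhd xs = nth_default Blank xs 0"
  by (cases xs) auto

lemma represents_read: "represents T z \<Longrightarrow> tape_read T = bhd (fst z)"
  unfolding represents_def bhd_nth_default
  by (cases T) (metis cancel_comm_monoid_add_class.diff_zero fst_conv of_nat_0 snd_conv tape_read.simps)

lemma represents_act:
  assumes "represents T z"
  shows "represents (tape_act a T) (zact a z)"
proof -
  obtain t i where T: "T = (t, i)" by (cases T)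
  obtain l r where z: "z = (l, r)" by (cases z)
  have L: "t (i - int k) = nth_default Blank l k" for k
    using assms by (auto simp: represents_def T z)
  have R: "t (i + 1 + int k) = nth_default Blank r k" for k
    using assms by (auto simp: represents_def T z)
  have L': "t (i - 1 - int k) = nth_default Blank l (Suc k)" for k
    using L[of "Suc k"] by (simp add: algebra_simps)
  have R': "t (i + 1 + 1 + int k) = nth_default Blank r (Suc k)" for k
    using R[of "Suc k"] by (simp add: algebra_simps)
  obtain s d where a: "a = (s, d)" by (cases a)
  show ?thesis
  proof (cases d)
    case MoveLeft
    have "(t(i := s)) (i - 1 + 1 + int k) = nth_default Blank (s # r) k" for k
      using R[of "k - 1"] by (cases k) (auto simp: algebra_simps)
    then show ?thesis using L'
      by (auto simp: represents_def T z a MoveLeft nth_default_bcons nth_default_tl)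
  next
    case MoveNone
    have "(t(i := s)) (i - int k) = nth_default Blank (s # tl l) k" for k
      using L[of k] by (cases k) (auto simp: nth_default_tl)
    then show ?thesis using R
      by (auto simp: represents_def T z a MoveNone nth_default_bcons)
  next
    case MoveRight
    have "(t(i := s)) (i + 1 - int k) = nth_default Blank (bhd r # (s ## tl l)) k" for k
    proof (cases k)
      case 0
      then show ?thesis using R[of 0] by (simp add: bhd_nth_default)
    next
      case (Suc j)
      then show ?thesis using L[of j]
        by (cases j) (auto simp: nth_default_bcons nth_default_tl algebra_simps)
    qed
    then show ?thesis using R'
      by (auto simp: represents_def T z a MoveRight nth_default_bcons nth_default_tl)
  qed
qed

lemma represents_blank: "represents blank_tape ([], [])"
  by (simp add: represents_def blank_tape_def)

text \<open>The start is written as a right move off the blank before the word. This form covers the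
  empty word too, and it is the position from which \<open>run_back\<close> and
  \<open>run_rewind\<close> start.\<close>

lemma represents_input: "represents (input_tape w) (zact (Blank, MoveRight) ([], map Letter w))"
proof (cases w)
  case Nil
  then show ?thesis by (auto simp: represents_def input_tape_def)
next
  case (Cons x xs)
  have "fst (input_tape w) (0 - int k) = nth_default Blank [Letter x] k" for k
    by (cases k) (auto simp: input_tape_def Cons)
  moreover have "fst (input_tape w) (0 + 1 + int k) = nth_default Blank (map Letter xs) k" for k
    by (auto simp: input_tape_def Cons nth_default_def nat_add_distrib)
  ultimately show ?thesis
    by (auto simp: represents_def Cons) (auto simp: input_tape_def)
qed

type_synonym ('q, 'a) delta2 =
  "'q \<Rightarrow> 'a symbol \<Rightarrow> 'a symbol \<Rightarrow> 'q \<times> ('a symbol \<times> move) \<times> ('a symbol \<times> move)"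

definition zstep :: "('q, 'a) delta2 \<Rightarrow> 'q set \<Rightarrow> 'q \<times> 'a zipper \<times> 'a zipper \<Rightarrow> 'q \<times> 'a zipper \<times> 'a zipper"
  where "zstep \<delta> F = (\<lambda>(q, z, z').
    if q \<in> F then (q, z, z')
    else case \<delta> q (bhd (fst z)) (bhd (fst z')) of (p, a, b) \<Rightarrow> (p, zact a z, zact b z'))"

lemma zstep_funpow_halted: "q \<in> F \<Longrightarrow> (zstep \<delta> F ^^ t) (q, z) = (q, z)"
  by (induction t) (auto simp: zstep_def split: prod.splits)

lemma zstep_halted_mono:
  assumes "fst ((zstep \<delta> F ^^ t) c) = q" "q \<in> F" "t \<le> t'"
  shows "fst ((zstep \<delta> F ^^ t') c) = q"
proof -
  obtain k where k: "t' = k + t" using assms(3) by (metis le_Suc_ex add.commute)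
  obtain z where "(zstep \<delta> F ^^ t) c = (q, z)" using assms(1) by (cases "(zstep \<delta> F ^^ t) c") auto
  then show ?thesis using zstep_funpow_halted[OF assms(2), where t = k and \<delta> = \<delta> and z = z] by (simp add: k funpow_add)
qed

text \<open>Any finite set of states will do, as \<open>to_nat_on\<close> numbers it. An upper bound
  on the halting time is enough because halting states are absorbing.\<close>

theorem polynomial_time_two_tapes:
  fixes \<delta> :: "('q, 'a) delta2" and p :: "nat poly" and start acc rej :: 'q
  assumes Q: "finite Q" "{start, acc, rej} \<subseteq> Q" "acc \<noteq> rej"
    and S: "finite S" "insert Blank (Letter ` A) \<subseteq> S"
    and \<delta>Q: "\<And>q a b. q \<in> Q \<Longrightarrow> fst (\<delta> q a b) \<in> Q"
    and \<delta>S: "\<And>q a b. q \<in> Q \<Longrightarrow> a \<in> S \<Longrightarrow> b \<in> S \<Longrightarrow> snd (\<delta> q a b) \<in> (S \<times> UNIV) \<times> (S \<times> UNIV)"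
    and L: "L \<subseteq> lists A"
    and run: "\<And>w. w \<in> lists A \<Longrightarrow> \<exists>t \<le> poly p (length w).
      fst ((zstep \<delta> {acc, rej} ^^ t) (start, zact (Blank, MoveRight) ([], map Letter w), [], []))
        = (if w \<in> L then acc else rej)"
  shows "polynomial_time A L"
proof -
  let ?e = "to_nat_on Q" and ?d = "from_nat_into Q"
  have cQ: "countable Q" using Q(1) by (rule countable_finite)
  have ed: "?d (?e q) = q" if "q \<in> Q" for q using cQ that by simp
  have inj: "?e q = ?e q' \<longleftrightarrow> q = q'" if "q \<in> Q" "q' \<in> Q" for q q' using cQ that by simp
  define M :: "'a tm" where "M = \<lparr> tm_tapes = 2, tm_states = ?e ` Q, tm_symbols = S,
     tm_start = ?e start, tm_accept = ?e acc, tm_reject = ?e rej,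
     tm_delta = (\<lambda>q ss. case \<delta> (?d q) (ss ! 0) (ss ! 1) of (q', a, b) \<Rightarrow> (?e q', [a, b])) \<rparr>"
  have tm: "turing_machine A M"
    unfolding turing_machine_def
  proof (intro conjI ballI impI)
    fix q ss assume q: "q \<in> tm_states M" and ss: "ss \<in> lists (tm_symbols M)" "length ss = tm_tapes M"
    obtain q0 where q0: "q0 \<in> Q" "q = ?e q0" using q by (auto simp: M_def)
    obtain a b where ab: "ss = [a, b]" "a \<in> S" "b \<in> S"
      using ss by (auto simp: M_def length_Suc_conv numeral_2_eq_2)
    obtain q' x y where d: "\<delta> q0 a b = (q', x, y)" by (metis prod_cases3)
    have "q' \<in> Q" using \<delta>Q[OF q0(1), of a b] by (simp add: d)
    moreover have "x \<in> S \<times> UNIV" "y \<in> S \<times> UNIV" using \<delta>S[OF q0(1) ab(2,3)] by (auto simp: d)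
    ultimately show "fst (tm_delta M q ss) \<in> tm_states M"
      "snd (tm_delta M q ss) \<in> lists (tm_symbols M \<times> UNIV)"
      "length (snd (tm_delta M q ss)) = tm_tapes M"
      by (auto simp: M_def ab d q0 ed)
  qed (use Q S inj in \<open>auto simp: M_def\<close>)
  \<comment> \<open>Steps on zippers and on tapes match one to one. The invariant includes
    \<open>q \<in> Q\<close> because \<open>?d\<close> inverts \<open>?e\<close> on \<open>Q\<close>
    only.\<close>
  have sim: "\<exists>q z z' T T'. (zstep \<delta> {acc, rej} ^^ t) (start, zact (Blank, MoveRight) ([], map Letter w), [], []) = (q, z, z')
      \<and> (tm_step M ^^ t) (tm_init M w) = (?e q, [T, T']) \<and> q \<in> Q \<and> represents T z \<and> represents T' z'"
    for w t
  proof (induction t)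
    case 0
    then show ?case
      using represents_input[of w] represents_blank Q(2)
      by (auto simp: tm_init_def M_def simp del: zact.simps)
  next
    case (Suc t)
    then obtain q z z' T T' where IH:
      "(zstep \<delta> {acc, rej} ^^ t) (start, zact (Blank, MoveRight) ([], map Letter w), [], []) = (q, z, z')"
      "(tm_step M ^^ t) (tm_init M w) = (?e q, [T, T'])"
      "q \<in> Q" "represents T z" "represents T' z'" by blast
    have F: "?e q \<in> {tm_accept M, tm_reject M} \<longleftrightarrow> q \<in> {acc, rej}"
      using inj[OF IH(3)] Q(2) by (auto simp: M_def)
    obtain q' a b where d: "\<delta> q (bhd (fst z)) (bhd (fst z')) = (q', a, b)" by (metis prod_cases3)
    have q': "q' \<in> Q" using \<delta>Q[OF IH(3), of "bhd (fst z)" "bhd (fst z')"] by (simp add: d)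
    show ?case
    proof (cases "q \<in> {acc, rej}")
      case True
      have "tm_step M (?e q, [T, T']) = (?e q, [T, T'])"
        using F True unfolding tm_step_def by auto
      moreover have "zstep \<delta> {acc, rej} (q, z, z') = (q, z, z')"
        using True by (auto simp: zstep_def)
      ultimately show ?thesis using IH by auto
    next
      case False
      have "tm_step M (?e q, [T, T']) = (?e q', [tape_act a T, tape_act b T'])"
        using F False unfolding tm_step_def
        by (simp add: M_def ed IH(3) d represents_read[OF IH(4)] represents_read[OF IH(5)])
      moreover have "zstep \<delta> {acc, rej} (q, z, z') = (q', zact a z, zact b z')"
        using False by (auto simp: zstep_def d)
      ultimately show ?thesis
        using IH q' represents_act[OF IH(4), of a] represents_act[OF IH(5), of b] by auto
    qed
  qed
  have "tm_state_after M w (poly p (length w)) = (if w \<in> L then tm_accept M else tm_reject M)"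
    if w: "w \<in> lists A" for w
  proof -
    let ?c = "(start, zact (Blank, MoveRight) ([], map Letter w), [], [])"
    have "fst ((zstep \<delta> {acc, rej} ^^ poly p (length w)) ?c) = (if w \<in> L then acc else rej)"
      using run[OF w] zstep_halted_mono[where F = "{acc, rej}" and \<delta> = \<delta>] by (metis insertCI)
    then show ?thesis
      using sim[of "poly p (length w)" w] by (auto simp: tm_state_after_def M_def)
  qed
  then show ?thesis unfolding polynomial_time_def using tm L by blast
qed

section \<open>The elimination machine\<close>

datatype 'a elim_state =
    Rewind | Top | Copy "'a symbol" | Back "'a symbol" | Row "'a symbol"
  | Sweep "'a symbol" "'a symbol" | Accept | Reject

text \<open>The matrix is read from right to left. A row \<open>(e, xs)\<close> belongs to a vertex \<open>v\<close>: the end symbol \<open>e\<close>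
  carries the unary constraint on \<open>v\<close>, and \<open>xs\<close> lists the constraints between \<open>v\<close> and
  \<open>v - 1, \<dots>, 0\<close>.\<close>

definition flat :: "('s \<times> 's list) list \<Rightarrow> 's list" where
  "flat rows = concat (map (\<lambda>(e, xs). e # xs) rows)"

lemma flat_simps [simp]: "flat [] = []" "flat ((e, xs) # rows) = e # xs @ flat rows"
  by (simp_all add: flat_def)

text \<open>\<open>Sd\<close> contains the end symbols and \<open>So\<close> the constraint symbols. When the vertex \<open>v\<close> with end symbol
  \<open>e\<close> is eliminated and \<open>y\<close> is the symbol of \<open>(v, u)\<close>, the end symbol \<open>e'\<close> of \<open>u\<close> becomes \<open>ud e y e'\<close>, and the
  symbol \<open>a\<close> of \<open>(u, w)\<close> becomes \<open>uo e y b a\<close>, where \<open>b\<close> is the symbol of \<open>(v, w)\<close>.\<close>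

locale elimination =
  fixes Sd So :: "'a symbol set"
    and dead :: "'a symbol \<Rightarrow> bool"
    and ud :: "'a symbol \<Rightarrow> 'a symbol \<Rightarrow> 'a symbol \<Rightarrow> 'a symbol"
    and uo :: "'a symbol \<Rightarrow> 'a symbol \<Rightarrow> 'a symbol \<Rightarrow> 'a symbol \<Rightarrow> 'a symbol"
  assumes finite_symbols: "finite Sd" "finite So"
    and disjoint: "Sd \<inter> So = {}"
    and nonblank: "Blank \<notin> Sd" "Blank \<notin> So"
    and ud_closed: "e \<in> Sd \<Longrightarrow> y \<in> So \<Longrightarrow> e' \<in> Sd \<Longrightarrow> ud e y e' \<in> Sd"
    and uo_closed: "e \<in> Sd \<Longrightarrow> y \<in> So \<Longrightarrow> b \<in> So \<Longrightarrow> a \<in> So \<Longrightarrow> uo e y b a \<in> So"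
begin

text \<open>\<open>Copy\<close> moves the row of the eliminated vertex to the second tape and erases
  it from the first. \<open>Row\<close> keeps the next copied symbol \<open>y\<close> in the state
  and erases it, so that the rest of the copy starts at the same vertex as the row to be swept and
  must have its length. \<open>Back\<close> returns the second head to the right end; the first head
  turns only for \<open>Rewind\<close>.\<close>

fun \<delta> :: "('a elim_state, 'a) delta2" where
  "\<delta> Rewind a b =
     (if a = Blank then (Top, (a, MoveLeft), (b, MoveNone)) else (Rewind, (a, MoveRight), (b, MoveNone)))"
| "\<delta> Top a b =
     (if a = Blank then (Accept, (a, MoveNone), (b, MoveNone))
      else if a \<in> Sd \<and> \<not> dead a then (Copy a, (Blank, MoveLeft), (b, MoveNone))
      else (Reject, (a, MoveNone), (b, MoveNone)))"
| "\<delta> (Copy e) a b =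
     (if a \<in> So then (Copy e, (Blank, MoveLeft), (a, MoveLeft))
      else (Back e, (a, MoveNone), (b, MoveRight)))"
| "\<delta> (Back e) a b =
     (if b = Blank then (Row e, (a, MoveNone), (b, MoveLeft)) else (Back e, (a, MoveNone), (b, MoveRight)))"
| "\<delta> (Row e) a b =
     (if a \<in> Sd \<and> b \<in> So then (Sweep e b, (ud e b a, MoveLeft), (Blank, MoveLeft))
      else if a = Blank \<and> b = Blank then (Rewind, (a, MoveRight), (b, MoveNone))
      else (Reject, (a, MoveNone), (b, MoveNone)))"
| "\<delta> (Sweep e y) a b =
     (if a \<in> So \<and> b \<in> So then (Sweep e y, (uo e y b a, MoveLeft), (b, MoveLeft))
      else if a \<in> So \<or> b \<in> So then (Reject, (a, MoveNone), (b, MoveNone))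
      else (Back e, (a, MoveNone), (b, MoveRight)))"
| "\<delta> Accept a b = (Accept, (a, MoveNone), (b, MoveNone))"
| "\<delta> Reject a b = (Reject, (a, MoveNone), (b, MoveNone))"

definition states :: "'a elim_state set" where
  "states = {Rewind, Top, Accept, Reject} \<union> Copy ` Sd \<union> Back ` Sd \<union> Row ` Sd \<union> (\<lambda>(e, y). Sweep e y) ` (Sd \<times> So)"

text \<open>\<open>None\<close> stands for lengths that do not fit a triangular matrix; the machine
  rejects there.\<close>

fun sweep :: "'a symbol \<Rightarrow> 'a symbol list \<Rightarrow> ('a symbol \<times> 'a symbol list) list
    \<Rightarrow> ('a symbol \<times> 'a symbol list) list option" where
  "sweep e [] [] = Some []"
| "sweep e (y # ys) ((e', zs) # rows) =
     (if length zs = length ys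
      then map_option (Cons (ud e y e', map2 (uo e y) ys zs)) (sweep e ys rows) else None)"
| "sweep e _ _ = None"

text \<open>Inductive, since the recursion continues with the swept rows, which are no part of the
  argument.\<close>

inductive feasible :: "('a symbol \<times> 'a symbol list) list \<Rightarrow> bool" where
  feasible_Nil: "feasible []"
| feasible_Cons: "\<not> dead e \<Longrightarrow> sweep e xs rows = Some rows' \<Longrightarrow> feasible rows' \<Longrightarrow> feasible ((e, xs) # rows)"

inductive_simps feasible_simps: "feasible ((e, xs) # rows)"

definition proper_rows :: "('a symbol \<times> 'a symbol list) list \<Rightarrow> bool" where
  "proper_rows rows \<longleftrightarrow> rows \<in> lists (Sd \<times> lists So)"

lemma proper_rows_simps [simp]:
  "proper_rows []" "proper_rows ((e, xs) # rows) \<longleftrightarrow> e \<in> Sd \<and> set xs \<subseteq> So \<and> proper_rows rows"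
  by (auto simp: proper_rows_def)

lemma sweep_proper:
  assumes "sweep e ys rows = Some rows'" "e \<in> Sd" "set ys \<subseteq> So" "proper_rows rows"
  shows "proper_rows rows'" "length rows' = length rows" "length (flat rows') = length (flat rows)"
  using assms
  by (induction e ys rows arbitrary: rows' rule: sweep.induct)
     (auto 0 4 simp: ud_closed split: if_splits intro!: uo_closed
           dest: set_zip_leftD set_zip_rightD subsetD)

lemma bhd_flat: "proper_rows rows \<Longrightarrow> bhd (flat rows) \<in> insert Blank Sd"
  by (cases rows) auto

text \<open>This is why \<open>Copy\<close> and \<open>Sweep\<close> notice the end of a
  row.\<close>

lemma bhd_flat_off: "proper_rows rows \<Longrightarrow> bhd (flat rows) \<notin> So"
  using bhd_flat[of rows] disjoint nonblank by auto

lemma nonblank': "x \<in> Sd \<Longrightarrow> x \<noteq> Blank" "x \<in> So \<Longrightarrow> x \<noteq> Blank"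
  using nonblank by auto

lemma stay_flat: "proper_rows rows \<Longrightarrow> bhd (flat rows) ## tl (flat rows) = flat rows"
  by (cases rows) (auto simp: nonblank')

section \<open>Reaching and halting within a number of steps\<close>

abbreviation step where "step \<equiv> zstep \<delta> {Accept, Reject}"

definition reaches where "reaches c k c' \<longleftrightarrow> (\<exists>t \<le> k. (step ^^ t) c = c')"

definition halts where "halts c k b \<longleftrightarrow> (\<exists>t \<le> k. fst ((step ^^ t) c) = (if b then Accept else Reject))"

lemma reaches_refl: "reaches c k c"
  unfolding reaches_def by (rule exI[of _ 0]) simp

lemma reaches_step: "reaches (step c) k c' \<Longrightarrow> reaches c (Suc k) c'"
  unfolding reaches_def by (metis Suc_le_mono comp_apply funpow_Suc_right)

lemma halts_step: "halts (step c) k b \<Longrightarrow> halts c (Suc k) b"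
  unfolding halts_def by (metis Suc_le_mono comp_apply funpow_Suc_right)

lemma halts_now: "fst c = (if b then Accept else Reject) \<Longrightarrow> halts c k b"
  unfolding halts_def by (rule exI[of _ 0]) simp

lemma reaches_trans:
  assumes "reaches c k c'" "reaches c' j c''"
  shows "reaches c (k + j) c''"
proof -
  obtain s t where "s \<le> k" "(step ^^ s) c = c'" "t \<le> j" "(step ^^ t) c' = c''"
    using assms unfolding reaches_def by blast
  then have "t + s \<le> k + j" "(step ^^ (t + s)) c = c''" by (simp_all add: funpow_add)
  then show ?thesis unfolding reaches_def by blast
qed

lemma reaches_halts:
  assumes "reaches c k c'" "halts c' j b"
  shows "halts c (k + j) b"
proof -
  obtain t c'' where "t \<le> j" "(step ^^ t) c' = c''" "fst c'' = (if b then Accept else Reject)"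
    using assms unfolding halts_def by blast
  then show ?thesis
    using reaches_trans[OF assms(1), of j c''] unfolding reaches_def halts_def by metis
qed

lemma reaches_mono: "reaches c k c' \<Longrightarrow> k \<le> k' \<Longrightarrow> reaches c k' c'"
  unfolding reaches_def using le_trans by blast

lemma halts_mono: "halts c k b \<Longrightarrow> k \<le> k' \<Longrightarrow> halts c k' b"
  unfolding halts_def using le_trans by blast

section \<open>Effect and cost of the phases of the machine\<close>

lemma run_copy:
  assumes "set xs \<subseteq> So"
  shows "reaches (Copy e, (xs @ l, []), ([], r)) (length xs) (Copy e, (l, []), ([], rev xs @ r))"
  using assms
proof (induction xs arbitrary: r)
  case Nil
  then show ?case by (simp add: reaches_refl)
next
  case (Cons x xs)
  have "step (Copy e, ((x # xs) @ l, []), ([], r)) = (Copy e, (xs @ l, []), ([], x # r))"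
    using Cons.prems by (simp add: zstep_def nonblank')
  then show ?case using Cons.IH[of "x # r"] Cons.prems reaches_step by fastforce
qed

lemma run_back_aux:
  assumes "y \<noteq> Blank" "Blank \<notin> set r" "bhd l1 ## tl l1 = l1"
  shows "reaches (Back e, (l1, r1), (y # l, r)) (length r + 2) (Row e, (l1, r1), (rev r @ y # l, []))"
  using assms
proof (induction r arbitrary: y l)
  case Nil
  have "step (Back e, (l1, r1), (y # l, [])) = (Back e, (l1, r1), (Blank # y # l, []))"
       "step (Back e, (l1, r1), (Blank # y # l, [])) = (Row e, (l1, r1), (y # l, []))"
    using Nil by (simp_all add: zstep_def)
  then show ?case by (simp add: reaches_step reaches_refl numeral_2_eq_2)
next
  case (Cons x r)
  have "step (Back e, (l1, r1), (y # l, x # r)) = (Back e, (l1, r1), (x # y # l, r))"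
    using Cons.prems by (simp add: zstep_def)
  then show ?case using Cons.IH[of x "y # l"] Cons.prems
    by (auto simp: reaches_step)
qed

text \<open>\<open>length ys\<close> moves lead to the blank behind the word, one more leads back.
  The premise on \<open>l1\<close> says that the resting first head rewrites its symbol without
  changing the zipper.\<close>

lemma run_back:
  assumes "Blank \<notin> set ys" "bhd l1 ## tl l1 = l1"
  shows "reaches (Back e, (l1, r1), zact (Blank, MoveRight) ([], ys)) (length ys + 1)
           (Row e, (l1, r1), (rev ys, []))"
proof (cases ys)
  case Nil
  have "step (Back e, (l1, r1), ([], [])) = (Row e, (l1, r1), ([], []))"
    using assms by (simp add: zstep_def)
  then show ?thesis by (simp add: Nil reaches_step reaches_refl)
next
  case (Cons y r)
  then show ?thesis using run_back_aux[of y r l1 e r1 "[]"] assms by auto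
qed

lemma run_rewind_aux:
  assumes "y \<noteq> Blank" "Blank \<notin> set r"
  shows "reaches (Rewind, (y # l, r), ([], [])) (length r + 2) (Top, (rev r @ y # l, []), ([], []))"
  using assms
proof (induction r arbitrary: y l)
  case Nil
  have "step (Rewind, (y # l, []), ([], [])) = (Rewind, (Blank # y # l, []), ([], []))"
       "step (Rewind, (Blank # y # l, []), ([], [])) = (Top, (y # l, []), ([], []))"
    using Nil by (simp_all add: zstep_def)
  then show ?case by (simp add: reaches_step reaches_refl numeral_2_eq_2)
next
  case (Cons x r)
  have "step (Rewind, (y # l, x # r), ([], [])) = (Rewind, (x # y # l, r), ([], []))"
    using Cons.prems by (simp add: zstep_def)
  then show ?case using Cons.IH[of x "y # l"] Cons.prems
    by (auto simp: reaches_step)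
qed

lemma run_rewind:
  assumes "Blank \<notin> set ys"
  shows "reaches (Rewind, zact (Blank, MoveRight) ([], ys), ([], [])) (length ys + 1)
           (Top, (rev ys, []), ([], []))"
proof (cases ys)
  case Nil
  have "step (Rewind, ([], []), ([], [])) = (Top, ([], []), ([], []))"
    using assms by (simp add: zstep_def)
  then show ?thesis by (simp add: Nil reaches_step reaches_refl)
next
  case (Cons y r)
  then show ?thesis using run_rewind_aux[of y r "[]"] assms by auto
qed

lemma run_sweep:
  assumes "length zs = length ys" "set zs \<subseteq> So" "set ys \<subseteq> So" "e \<in> Sd" "y \<in> So"
  shows "reaches (Sweep e y, (zs @ l, r1), (ys, r2)) (length ys)
           (Sweep e y, (l, rev (map2 (uo e y) ys zs) @ r1), ([], rev ys @ r2))"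
  using assms
proof (induction zs ys arbitrary: r1 r2 rule: list_induct2)
  case Nil
  then show ?case by (simp add: reaches_refl)
next
  case (Cons a zs b ys)
  have "step (Sweep e y, ((a # zs) @ l, r1), (b # ys, r2)) =
        (Sweep e y, (zs @ l, uo e y b a # r1), (ys, b # r2))"
    using Cons.prems uo_closed[of e y b a] by (simp add: zstep_def nonblank')
  then show ?case
    using Cons.IH[of "uo e y b a # r1" "b # r2"] Cons.prems
    by (simp add: reaches_step)
qed

text \<open>Where the shorter word ends, exactly one head is on a constraint symbol, which makes
  \<open>Sweep\<close> reject; \<open>bhd l \<notin> So\<close> makes the end of \<open>zs\<close>
  visible.\<close>

lemma run_sweep_mismatch:
  assumes "length zs \<noteq> length ys" "set zs \<subseteq> So" "set ys \<subseteq> So" "e \<in> Sd" "y \<in> So" "bhd l \<notin> So"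
  shows "halts (Sweep e y, (zs @ l, r1), (ys, r2)) (length ys + 1) False"
  using assms
proof (induction ys arbitrary: zs r1 r2)
  case Nil
  then obtain a zs' where zs: "zs = a # zs'" by (cases zs) auto
  have "fst (step (Sweep e y, (zs @ l, r1), ([], r2))) = Reject"
    using Nil zs nonblank by (simp add: zstep_def)
  then show ?case using halts_step[OF halts_now] by auto
next
  case (Cons b ys)
  show ?case
  proof (cases zs)
    case Nil
    have "fst (step (Sweep e y, (zs @ l, r1), (b # ys, r2))) = Reject"
      using Cons.prems Nil by (simp add: zstep_def)
    then show ?thesis using halts_step[OF halts_now] by auto
  next
    case zs: (Cons a zs')
    have "step (Sweep e y, (zs @ l, r1), (b # ys, r2)) =
        (Sweep e y, (zs' @ l, uo e y b a # r1), (ys, b # r2))"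
      using Cons.prems uo_closed[of e y b a] zs by (simp add: zstep_def nonblank')
    then show ?thesis using Cons.IH[of zs' "uo e y b a # r1" "b # r2"] Cons.prems zs
      by (simp add: halts_step)
  qed
qed

text \<open>There is one round per copied symbol and a last step. A round with
  \<open>length ys\<close> symbols left is a sweep and a return of the second head,
  \<open>2 * length ys + 1\<close> steps. The rewritten rows pile up in reverse to the right of the
  first head, ready for \<open>Rewind\<close>.\<close>

lemma run_rows:
  assumes "proper_rows rows" "set ys \<subseteq> So" "e \<in> Sd"
  shows "case sweep e ys rows of
      None \<Rightarrow> halts (Row e, (flat rows, r1), (ys, [])) (Suc (length ys) * (2 * length ys + 1)) False
    | Some rows' \<Rightarrow> reaches (Row e, (flat rows, r1), (ys, [])) (Suc (length ys) * (2 * length ys + 1))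
        (Rewind, zact (Blank, MoveRight) ([], rev (flat rows') @ r1), ([], []))"
  using assms
proof (induction ys arbitrary: rows r1)
  case Nil
  show ?case
  proof (cases rows)
    case Nil
    have "step (Row e, ([], r1), ([], [])) = (Rewind, zact (Blank, MoveRight) ([], r1), ([], []))"
      using nonblank by (simp add: zstep_def)
    then show ?thesis by (simp add: Nil reaches_step reaches_refl)
  next
    case (Cons row rows')
    then obtain e' zs where row: "rows = (e', zs) # rows'" by (cases row) auto
    have "fst (step (Row e, (flat rows, r1), ([], []))) = Reject"
      using nonblank Nil.prems by (auto simp: zstep_def row)
    then show ?thesis using halts_step[OF halts_now] by (auto simp: row)
  qed
next
  case (Cons y ys)
  let ?n = "length ys"
  \<comment> \<open>One step of \<open>Row\<close>, \<open>?n\<close> of \<open>Sweep\<close>, one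
    into \<open>Back\<close> and \<open>?n + 1\<close> of \<open>Back\<close> make up the first
    summand; the second is the induction hypothesis.\<close>
  have bound: "(?n + 2 + (?n + 1)) + Suc ?n * (2 * ?n + 1) \<le> Suc (length (y # ys)) * (2 * length (y # ys) + 1)"
    by (simp add: algebra_simps)
  have y: "y \<in> So" and ys: "set ys \<subseteq> So" using Cons.prems by auto
  show ?case
  proof (cases rows)
    case Nil
    have "fst (step (Row e, ([], r1), (y # ys, []))) = Reject"
      using nonblank y by (auto simp: zstep_def)
    then show ?thesis using halts_step[OF halts_now] by (auto simp: Nil)
  next
    case (Cons row rows')
    then obtain e' zs where row: "rows = (e', zs) # rows'" by (cases row) auto
    have e': "e' \<in> Sd" and zs: "set zs \<subseteq> So" and p: "proper_rows rows'"
      using Cons.prems by (auto simp: row)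
    let ?u = "ud e y e'"
    have u: "?u \<in> Sd" using ud_closed Cons.prems(3) y e' by auto
    have s1: "step (Row e, (flat rows, r1), (y # ys, [])) = (Sweep e y, (zs @ flat rows', ?u # r1), (ys, []))"
      using e' y u by (simp add: zstep_def row nonblank')
    show ?thesis
    proof (cases "length zs = ?n")
      case False
      have "halts (Sweep e y, (zs @ flat rows', ?u # r1), (ys, [])) (?n + 1) False"
        using run_sweep_mismatch[OF False zs ys Cons.prems(3) y bhd_flat_off[OF p]] by simp
      then have "halts (Row e, (flat rows, r1), (y # ys, [])) (Suc (?n + 1)) False"
        using halts_step s1 by metis
      then have "halts (Row e, (flat rows, r1), (y # ys, [])) (Suc (length (y # ys)) * (2 * length (y # ys) + 1)) False"
        by (rule halts_mono) simp
      then show ?thesis using False by (simp add: row)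
    next
      case True
      let ?zs = "map2 (uo e y) ys zs"
      let ?r = "rev ?zs @ ?u # r1"
      have s2: "step (Sweep e y, (flat rows', ?r), ([], rev ys)) =
          (Back e, (flat rows', ?r), zact (Blank, MoveRight) ([], rev ys))"
        using bhd_flat_off[OF p] nonblank by (simp add: zstep_def stay_flat[OF p])
      have s3: "reaches (Back e, (flat rows', ?r), zact (Blank, MoveRight) ([], rev ys)) (?n + 1)
          (Row e, (flat rows', ?r), (ys, []))"
        using run_back[of "rev ys" "flat rows'" e ?r] ys nonblank stay_flat[OF p]
        by (auto simp del: zact.simps)
      have "reaches (Row e, (flat rows, r1), (y # ys, [])) (Suc ?n)
          (Sweep e y, (flat rows', ?r), ([], rev ys))"
        using reaches_step run_sweep[OF True zs ys Cons.prems(3) y, of "flat rows'" "?u # r1" "[]"] s1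
        by (metis append_Nil2)
      then have *: "reaches (Row e, (flat rows, r1), (y # ys, [])) (?n + 2 + (?n + 1)) (Row e, (flat rows', ?r), (ys, []))"
        using reaches_trans[OF _ reaches_step[of _ "?n + 1"], of _ "Suc ?n"] s2 s3 by fastforce
      note IH = Cons.IH[OF p ys Cons.prems(3), of ?r]
      show ?thesis
      proof (cases "sweep e ys rows'")
        case None
        with IH have "halts (Row e, (flat rows', ?r), (ys, [])) (Suc ?n * (2 * ?n + 1)) False" by simp
        from halts_mono[OF reaches_halts[OF * this] bound] show ?thesis
          by (simp add: row True None)
      next
        case (Some rows'')
        with IH have "reaches (Row e, (flat rows', ?r), (ys, [])) (Suc ?n * (2 * ?n + 1))
          (Rewind, zact (Blank, MoveRight) ([], rev (flat rows'') @ ?r), ([], []))" by simp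
        from reaches_mono[OF reaches_trans[OF * this] bound] show ?thesis
          by (simp add: row True Some del: zact.simps)
      qed
    qed
  qed
qed

lemma flat_nonblank: "proper_rows rows \<Longrightarrow> Blank \<notin> set (flat rows)"
  using nonblank by (induction rows) auto

text \<open>Here \<open>n\<close> is the length of the eliminated row, \<open>k\<close> that of the
  remaining rows and \<open>s\<close> that of the whole tape. The tape loses at least the end
  symbol, so the cubic bound drops by a multiple of \<open>s * s\<close>, which pays for the
  quadratic cost of one elimination.\<close>

lemma time_bound:
  fixes n k s :: nat
  assumes "Suc (n + k) \<le> s"
  shows "n + 2 + (n + 1) + Suc n * (2 * n + 1) + (k + 1) + 4 * (k + 1) ^ 3 \<le> 4 * (s + 1) ^ 3"
proof -
  have "Suc n * (2 * n + 1) \<le> s * (2 * s)" using assms by (intro mult_mono) auto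
  moreover have "(k + 1) ^ 3 \<le> s ^ 3" using assms by (intro power_mono) auto
  moreover have "4 * (s + 1) ^ 3 = 4 * s ^ 3 + 12 * (s * s) + 12 * s + 4"
    by (simp add: power3_eq_cube algebra_simps)
  moreover have "s * (2 * s) = 2 * (s * s)" by simp
  ultimately show ?thesis using assms by linarith
qed

text \<open>The induction is on the number of rows: sweeping replaces the rows but keeps their
  number and their total length, as \<open>sweep_proper\<close> shows.\<close>

lemma run_top:
  assumes "proper_rows rows"
  shows "halts (Top, (flat rows, []), ([], [])) (4 * (length (flat rows) + 1) ^ 3) (feasible rows)"
  using assms
proof (induction "length rows" arbitrary: rows)
  case 0
  have "fst (step (Top, ([], []), ([], []))) = Accept"
    by (simp add: zstep_def)
  then have "halts (Top, ([], []), ([], [])) (Suc 3) True"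
    by - (rule halts_step, rule halts_now, simp)
  then show ?case using 0 feasible_Nil by simp
next
  case (Suc k)
  then obtain e xs rows1 where rows: "rows = (e, xs) # rows1" by (cases rows) auto
  have e: "e \<in> Sd" and xs: "set xs \<subseteq> So" and p: "proper_rows rows1" using Suc.prems by (auto simp: rows)
  let ?n = "length xs" and ?s = "length (flat rows)" and ?s1 = "length (flat rows1)"
  show ?case
  proof (cases "dead e")
    case True
    have "fst (step (Top, (flat rows, []), ([], []))) = Reject"
      using True e by (simp add: zstep_def rows nonblank')
    then have "halts (Top, (flat rows, []), ([], [])) (Suc 0) False"
      using halts_step[OF halts_now] by auto
    then have "halts (Top, (flat rows, []), ([], [])) (4 * (?s + 1) ^ 3) False"
      by (rule halts_mono) (simp add: power3_eq_cube)
    then show ?thesis using True by (simp add: rows feasible_simps)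
  next
    case False
    have s1: "step (Top, (flat rows, []), ([], [])) = (Copy e, (xs @ flat rows1, []), ([], []))"
      using False e by (simp add: zstep_def rows nonblank')
    have s2: "step (Copy e, (flat rows1, []), ([], rev xs)) =
        (Back e, (flat rows1, []), zact (Blank, MoveRight) ([], rev xs))"
      using bhd_flat_off[OF p] by (simp add: zstep_def stay_flat[OF p])
    have s3: "reaches (Back e, (flat rows1, []), zact (Blank, MoveRight) ([], rev xs)) (?n + 1)
        (Row e, (flat rows1, []), (xs, []))"
      using run_back[of "rev xs" "flat rows1" e "[]"] xs nonblank stay_flat[OF p]
      by (auto simp del: zact.simps)
    have "reaches (Top, (flat rows, []), ([], [])) (Suc ?n) (Copy e, (flat rows1, []), ([], rev xs))"
      using reaches_step run_copy[OF xs, of e "flat rows1" "[]"] s1 by (metis append_Nil2)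
    then have *: "reaches (Top, (flat rows, []), ([], [])) (?n + 2 + (?n + 1)) (Row e, (flat rows1, []), (xs, []))"
      using reaches_trans[OF _ reaches_step[of _ "?n + 1"], of _ "Suc ?n"] s2 s3 by fastforce
    note R = run_rows[OF p xs e, of "[]"]
    have len: "?s = Suc (?n + ?s1)" by (simp add: rows)
    show ?thesis
    proof (cases "sweep e xs rows1")
      case None
      with R have "halts (Row e, (flat rows1, []), (xs, [])) (Suc ?n * (2 * ?n + 1)) False" by simp
      from reaches_halts[OF * this]
      have "halts (Top, (flat rows, []), ([], [])) (4 * (?s + 1) ^ 3) False"
        by (rule halts_mono) (use time_bound[of ?n ?s1 ?s] len in linarith)
      then show ?thesis using None by (simp add: rows feasible_simps)
    next
      case (Some rows2)
      note pr = sweep_proper[OF Some e xs p]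
      have "reaches (Row e, (flat rows1, []), (xs, [])) (Suc ?n * (2 * ?n + 1))
          (Rewind, zact (Blank, MoveRight) ([], rev (flat rows2)), ([], []))" using R Some by simp
      note ** = reaches_trans[OF * this]
      have "reaches (Rewind, zact (Blank, MoveRight) ([], rev (flat rows2)), ([], [])) (?s1 + 1)
          (Top, (flat rows2, []), ([], []))"
        using run_rewind[of "rev (flat rows2)"] flat_nonblank[OF pr(1)] pr(3) by simp
      note *** = reaches_trans[OF ** this]
      have "halts (Top, (flat rows2, []), ([], [])) (4 * (?s1 + 1) ^ 3) (feasible rows2)"
        using Suc(1)[of rows2] Suc(2) pr by (simp add: rows)
      from reaches_halts[OF *** this]
      have "halts (Top, (flat rows, []), ([], [])) (4 * (?s + 1) ^ 3) (feasible rows2)"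
        by (rule halts_mono) (use time_bound[of ?n ?s1 ?s] len in linarith)
      then show ?thesis using Some False by (simp add: rows feasible_simps)
    qed
  qed
qed

text \<open>Read from the right, a word splits uniquely into a run of constraint symbols and a list
  of rows. If the run is nonempty, the word is no list of rows, and \<open>Top\<close> rejects at
  once because it meets a constraint symbol.\<close>

theorem polynomial_time_feasible:
  assumes A: "finite A" "Letter ` A \<subseteq> Sd \<union> So"
  shows "polynomial_time A {w \<in> lists A. \<exists>rows. proper_rows rows \<and> rev (map Letter w) = flat rows \<and> feasible rows}"
    (is "polynomial_time A ?L")
proof (rule polynomial_time_two_tapes[where Q = states and S = "insert Blank (Sd \<union> So)" and \<delta> = \<delta>
      and start = Rewind and acc = Accept and rej = Reject and p = "smult 5 ([:1, 1:] ^ 3)"])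
  show "finite states" using finite_symbols by (simp add: states_def)
  show "fst (\<delta> q a b) \<in> states" if "q \<in> states" for q a b
    using that by (cases q) (auto simp: states_def)
  show "snd (\<delta> q a b) \<in> (insert Blank (Sd \<union> So) \<times> UNIV) \<times> (insert Blank (Sd \<union> So) \<times> UNIV)"
    if "q \<in> states" "a \<in> insert Blank (Sd \<union> So)" "b \<in> insert Blank (Sd \<union> So)" for q a b
    using that by (cases q) (auto simp: states_def ud_closed uo_closed)
  fix w assume w: "w \<in> lists A"
  let ?w = "map Letter w" and ?n = "length w"
  have wS: "set ?w \<subseteq> Sd \<union> So" using w A by auto
  have split: "\<exists>xs rows. v = xs @ flat rows \<and> set xs \<subseteq> So \<and> proper_rows rows"
    if "set v \<subseteq> Sd \<union> So" for v :: "'a symbol list"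
    using that
  proof (induction v)
    case Nil
    then show ?case by (rule_tac exI[of _ "[]"], rule_tac exI[of _ "[]"]) simp
  next
    case (Cons a v)
    then obtain xs rows where v: "v = xs @ flat rows" "set xs \<subseteq> So" "proper_rows rows" by auto
    show ?case
    proof (cases "a \<in> So")
      case True
      then show ?thesis using v by (rule_tac exI[of _ "a # xs"], rule_tac exI[of _ rows]) simp
    next
      case False
      then show ?thesis using v Cons.prems
        by (rule_tac exI[of _ "[]"], rule_tac exI[of _ "(a, xs) # rows"]) simp
    qed
  qed
  have uniq: "xs = [] \<and> rows = rows'" if "xs @ flat rows = flat rows'" "set xs \<subseteq> So" "proper_rows rows" "proper_rows rows'"
    for xs rows rows'
    using that
  proof (induction rows' arbitrary: xs rows)
    case Nil
    then show ?case by (cases rows) auto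
  next
    case (Cons row rows')
    obtain e ys where row: "row = (e, ys)" by (cases row)
    have e: "e \<in> Sd" using Cons.prems by (simp add: row)
    have "xs = []" using Cons.prems e disjoint by (cases xs) (auto simp: row)
    then obtain zs rows1 where r: "rows = (e, zs) # rows1" "zs @ flat rows1 = ys @ flat rows'"
      using Cons.prems by (cases rows) (auto simp: row)
    have zs: "set zs \<subseteq> So" and ys: "set ys \<subseteq> So" and p: "proper_rows rows1" "proper_rows rows'"
      using Cons.prems by (auto simp: r row)
    consider us where "zs = ys @ us" "us @ flat rows1 = flat rows'"
      | us where "ys = zs @ us" "flat rows1 = us @ flat rows'"
      using r(2) by (auto simp: append_eq_append_conv2)
    then show ?case
    proof cases
      case 1
      then have "us = [] \<and> rows1 = rows'" using Cons.IH[of us rows1] zs p by auto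
      then show ?thesis using 1 \<open>xs = []\<close> by (simp add: r row)
    next
      case 2
      have "us = []"
      proof (cases us)
        case (Cons u us')
        then show ?thesis using 2 bhd_flat_off[OF p(1)] ys by auto
      qed simp
      then have "rows1 = rows'" using Cons.IH[of "[]" rows1] 2 p by auto
      then show ?thesis using 2 \<open>us = []\<close> \<open>xs = []\<close> by (simp add: r row)
    qed
  qed
  have rew: "reaches (Rewind, zact (Blank, MoveRight) ([], ?w), ([], [])) (?n + 1) (Top, (rev ?w, []), ([], []))"
    using run_rewind[of ?w] by (auto simp del: zact.simps)
  obtain xs rows where v: "rev ?w = xs @ flat rows" "set xs \<subseteq> So" "proper_rows rows"
    using split[of "rev ?w"] wS by auto
  have "halts (Top, (rev ?w, []), ([], [])) (4 * (?n + 1) ^ 3) (w \<in> ?L)"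
  proof (cases xs)
    case Nil
    have "w \<in> ?L \<longleftrightarrow> feasible rows"
      using uniq[of "[]" rows] v w Nil by auto
    moreover have "length (flat rows) = ?n"
      using v Nil by (metis append_Nil length_map length_rev)
    ultimately show ?thesis using run_top[OF v(3)] v Nil by simp
  next
    case (Cons x xs')
    have "(w \<in> ?L) = False"
      using uniq[of xs rows] v w Cons by auto
    moreover have "fst (step (Top, (rev ?w, []), ([], []))) = Reject"
      using v Cons disjoint by (auto simp: zstep_def nonblank')
    then have "halts (Top, (rev ?w, []), ([], [])) (Suc 0) False"
      using halts_step[OF halts_now] by auto
    then have "halts (Top, (rev ?w, []), ([], [])) (4 * (?n + 1) ^ 3) False"
      by (rule halts_mono) (simp add: power3_eq_cube)
    ultimately show ?thesis by (simp only:)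
  qed
  \<comment> \<open>The initial rewinding takes \<open>?n + 1 \<le> (?n + 1) ^ 3\<close> steps,
    which turns the factor 4 into 5.\<close>
  from reaches_halts[OF rew this]
  have "halts (Rewind, zact (Blank, MoveRight) ([], ?w), ([], [])) (5 * (?n + 1) ^ 3) (w \<in> ?L)"
    by (rule halts_mono) (use self_le_power[of "?n + 1" 3] in simp)
  then show "\<exists>t\<le>poly (smult 5 ([:1, 1:] ^ 3)) ?n. fst ((step ^^ t) (Rewind, zact (Blank, MoveRight) ([], ?w), [], []))
        = (if w \<in> ?L then Accept else Reject)"
    unfolding halts_def by (simp add: poly_power add.commute)
qed (use A finite_symbols in \<open>auto simp: states_def\<close>)

end

section \<open>Constraint satisfaction by vertex elimination\<close>

definition partial_bij :: "('d \<times> 'd) set \<Rightarrow> bool" where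
  "partial_bij R \<longleftrightarrow> single_valued R \<and> single_valued (R\<inverse>)"

text \<open>Values are listed like the rows, the last vertex first, and a pair has the value of the
  smaller vertex in front. As \<open>list_all2\<close> compares lengths, only triangular lists can
  be satisfied.\<close>

fun sat :: "('s \<Rightarrow> 'd set) \<Rightarrow> ('s \<Rightarrow> ('d \<times> 'd) set) \<Rightarrow> ('s \<times> 's list) list \<Rightarrow> 'd list \<Rightarrow> bool" where
  "sat du dr [] [] = True"
| "sat du dr ((e, xs) # rows) (d # ds) \<longleftrightarrow>
     d \<in> du e \<and> list_all2 (\<lambda>x d'. (d', d) \<in> dr x) xs ds \<and> sat du dr rows ds"
| "sat du dr _ _ = False"

lemma sat_map: "sat du dr (map (map_prod g (map g)) rows) ds = sat (du \<circ> g) (dr \<circ> g) rows ds"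
  by (induction "du \<circ> g" "dr \<circ> g" rows ds rule: sat.induct) (auto simp: list.rel_map)

lemma sat_length: "sat du dr rows ds \<Longrightarrow> length rows = length ds"
  by (induction du dr rows ds rule: sat.induct) auto

text \<open>Composing with a full constraint would give a rectangle, in general neither full nor a
  partial bijection. So \<open>dr_uo\<close> leaves \<open>dr a\<close> alone in this case; what a
  rectangle says about single vertices is recorded by \<open>du_ud\<close>.\<close>

locale csp_elimination = elimination Sd So dead ud uo
  for Sd So :: "'a symbol set" and dead ud uo +
  fixes D :: "'d set" and du :: "'a symbol \<Rightarrow> 'd set" and dr :: "'a symbol \<Rightarrow> ('d \<times> 'd) set"
  assumes du_D: "e \<in> Sd \<Longrightarrow> du e \<subseteq> D"
    and dead: "e \<in> Sd \<Longrightarrow> dead e \<longleftrightarrow> du e = {}"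
    and dr_cases: "y \<in> So \<Longrightarrow> dr y = D \<times> D \<or> partial_bij (dr y)"
    and du_ud: "e \<in> Sd \<Longrightarrow> y \<in> So \<Longrightarrow> e' \<in> Sd \<Longrightarrow> du (ud e y e') = {x \<in> du e'. \<exists>d \<in> du e. (x, d) \<in> dr y}"
    and dr_uo: "e \<in> Sd \<Longrightarrow> y \<in> So \<Longrightarrow> b \<in> So \<Longrightarrow> a \<in> So \<Longrightarrow> dr (uo e y b a) =
      (if dr y = D \<times> D \<or> dr b = D \<times> D then dr a
       else {(x', x) \<in> dr a. \<exists>d \<in> du e. (x', d) \<in> dr b \<and> (x, d) \<in> dr y})"
begin

definition linked :: "'a symbol \<Rightarrow> 'a symbol \<Rightarrow> 'd \<Rightarrow> 'a symbol \<Rightarrow> 'd \<Rightarrow> bool" where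
  "linked e y x b x' \<longleftrightarrow> dr y = D \<times> D \<or> dr b = D \<times> D \<or> (\<exists>d \<in> du e. (x', d) \<in> dr b \<and> (x, d) \<in> dr y)"

text \<open>What remains of the constraints at the eliminated vertex: a condition on each neighbour
  and one on each pair of neighbours.\<close>

fun compatible :: "'a symbol \<Rightarrow> 'a symbol list \<Rightarrow> 'd list \<Rightarrow> bool" where
  "compatible e [] [] = True"
| "compatible e (y # ys) (x # ds) \<longleftrightarrow>
     (\<exists>d \<in> du e. (x, d) \<in> dr y) \<and> list_all2 (linked e y x) ys ds \<and> compatible e ys ds"
| "compatible e _ _ = False"

lemma sat_D: "sat du dr rows ds \<Longrightarrow> proper_rows rows \<Longrightarrow> set ds \<subseteq> D"
proof (induction rows arbitrary: ds)
  case Nil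
  then show ?case by (cases ds) auto
next
  case (Cons row rows)
  then show ?case by (cases row; cases ds) (use du_D in auto)
qed

lemma list_all2_uo:
  assumes "length ys = length zs" "e \<in> Sd" "y \<in> So" "set ys \<subseteq> So" "set zs \<subseteq> So"
  shows "list_all2 (\<lambda>a x'. (x', x) \<in> dr a) (map2 (uo e y) ys zs) ds \<longleftrightarrow>
    list_all2 (\<lambda>a x'. (x', x) \<in> dr a) zs ds \<and> list_all2 (linked e y x) ys ds"
  using assms
proof (induction ys zs arbitrary: ds rule: list_induct2)
  case (Cons b ys a zs)
  then show ?case by (cases ds) (auto simp: dr_uo linked_def)
qed simp

lemma sat_sweep:
  assumes "sweep e ys rows = Some rows'" "e \<in> Sd" "set ys \<subseteq> So" "proper_rows rows"
  shows "sat du dr rows' ds \<longleftrightarrow> sat du dr rows ds \<and> compatible e ys ds"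
  using assms
proof (induction e ys rows arbitrary: rows' ds rule: sweep.induct)
  case (1 e)
  then show ?case by (cases ds) auto
next
  case (2 e y ys e' zs rows)
  then obtain r where r: "length zs = length ys" "sweep e ys rows = Some r"
    "rows' = (ud e y e', map2 (uo e y) ys zs) # r" by (auto split: if_splits)
  show ?case
  proof (cases ds)
    case (Cons x ds')
    have "sat du dr r ds' \<longleftrightarrow> sat du dr rows ds' \<and> compatible e ys ds'"
      using 2 r by auto
    moreover have "list_all2 (\<lambda>a x'. (x', x) \<in> dr a) (map2 (uo e y) ys zs) ds' \<longleftrightarrow>
      list_all2 (\<lambda>a x'. (x', x) \<in> dr a) zs ds' \<and> list_all2 (linked e y x) ys ds'"
      using 2 r by (intro list_all2_uo) auto
    ultimately show ?thesis
      using 2 by (auto simp: r Cons du_ud)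
  qed (simp add: r)
qed auto

text \<open>Satisfiability forces the triangular shape that \<open>sweep\<close> checks.\<close>

lemma sweep_defined: "length ys = length ds \<Longrightarrow> sat du dr rows ds \<Longrightarrow> \<exists>rows'. sweep e ys rows = Some rows'"
proof (induction e ys rows arbitrary: ds rule: sweep.induct)
  case (2 e y ys e' zs rows)
  then obtain x ds' where ds: "ds = x # ds'" by (cases ds) auto
  then have "length zs = length ys" "\<exists>r. sweep e ys rows = Some r"
    using 2 by (auto dest: list_all2_lengthD)
  then show ?case by auto
qed (auto dest: sat_length)

text \<open>A Helly property. The first constraint that is not full is single valued, so it
  determines \<open>d\<close> from the value \<open>x\<close>, and every \<open>linked\<close>
  condition of a later non-full constraint must have this same \<open>d\<close> as its witness. Full
  constraints hold for any \<open>d\<close>; if there are no others, \<open>du e \<noteq> {}\<close>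
  supplies the value.\<close>

lemma compatible_iff:
  assumes "e \<in> Sd" "set ys \<subseteq> So" "set ds \<subseteq> D"
  shows "(\<exists>d \<in> du e. list_all2 (\<lambda>y x. (x, d) \<in> dr y) ys ds) \<longleftrightarrow> du e \<noteq> {} \<and> compatible e ys ds"
proof
  assume "\<exists>d \<in> du e. list_all2 (\<lambda>y x. (x, d) \<in> dr y) ys ds"
  then obtain d where d: "d \<in> du e" "list_all2 (\<lambda>y x. (x, d) \<in> dr y) ys ds" by blast
  have "compatible e ys ds"
    using d(2)
  proof (induction ys ds rule: list_all2_induct)
    case (Cons y ys x ds)
    have "list_all2 (linked e y x) ys ds"
      using Cons.hyps(2) by (rule list_all2_mono) (use Cons.hyps(1) d(1) in \<open>auto simp: linked_def\<close>)
    then show ?case using Cons d(1) by auto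
  qed simp
  then show "du e \<noteq> {} \<and> compatible e ys ds" using d by auto
next
  assume "du e \<noteq> {} \<and> compatible e ys ds"
  then have "du e \<noteq> {}" "compatible e ys ds" by auto
  then show "\<exists>d \<in> du e. list_all2 (\<lambda>y x. (x, d) \<in> dr y) ys ds"
    using assms
  proof (induction e ys ds rule: compatible.induct)
    case (2 e y ys x ds)
    show ?case
    proof (cases "dr y = D \<times> D")
      case True
      obtain d where "d \<in> du e" "list_all2 (\<lambda>y x. (x, d) \<in> dr y) ys ds" using 2 by auto
      then show ?thesis using True 2 du_D[of e] by auto
    next
      case False
      then have sv: "single_valued (dr y)" using dr_cases[of y] 2 by (auto simp: partial_bij_def)
      obtain d where d: "d \<in> du e" "(x, d) \<in> dr y" using 2 by auto
      have "(x', d) \<in> dr b" if "linked e y x b x'" "x' \<in> D" for b x'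
        using that False d single_valuedD[OF sv] du_D[OF 2(4)] unfolding linked_def by auto
      then have "list_all2 (\<lambda>y x. (x, d) \<in> dr y) ys ds"
        using 2 by (auto simp: list_all2_conv_all_nth subset_iff)
      then show ?thesis using d by auto
    qed
  qed auto
qed

lemma feasible_iff_sat: "proper_rows rows \<Longrightarrow> feasible rows \<longleftrightarrow> (\<exists>ds. sat du dr rows ds)"
proof (induction "length rows" arbitrary: rows)
  case 0
  then show ?case using feasible_Nil by (auto intro!: exI[of _ "[]"])
next
  case (Suc k)
  then obtain e xs rows1 where rows: "rows = (e, xs) # rows1" by (cases rows) auto
  have e: "e \<in> Sd" and xs: "set xs \<subseteq> So" and p: "proper_rows rows1" using Suc.prems by (auto simp: rows)
  have "(\<exists>ds. sat du dr rows ds) \<longleftrightarrow>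
      (\<exists>ds. sat du dr rows1 ds \<and> (\<exists>d \<in> du e. list_all2 (\<lambda>x d'. (d', d) \<in> dr x) xs ds))"
  proof
    assume "\<exists>ds. sat du dr rows ds"
    then obtain ds where "sat du dr rows ds" ..
    then show "\<exists>ds. sat du dr rows1 ds \<and> (\<exists>d \<in> du e. list_all2 (\<lambda>x d'. (d', d) \<in> dr x) xs ds)"
      by (cases ds) (auto simp: rows)
  next
    assume "\<exists>ds. sat du dr rows1 ds \<and> (\<exists>d \<in> du e. list_all2 (\<lambda>x d'. (d', d) \<in> dr x) xs ds)"
    then obtain ds d where "sat du dr rows (d # ds)" by (auto simp: rows)
    then show "\<exists>ds. sat du dr rows ds" ..
  qed
  \<comment> \<open>\<open>compatible_iff\<close> gets rid of the value at the eliminated vertex;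
    \<open>sat_sweep\<close> then absorbs the remaining condition into the rows.\<close>
  also have "\<dots> \<longleftrightarrow> du e \<noteq> {} \<and> (\<exists>ds. sat du dr rows1 ds \<and> compatible e xs ds)"
    using compatible_iff[OF e xs] sat_D[OF _ p] by blast
  also have "\<dots> \<longleftrightarrow> \<not> dead e \<and> (\<exists>rows2. sweep e xs rows1 = Some rows2 \<and> (\<exists>ds. sat du dr rows2 ds))"
  proof -
    have "length xs = length ds" if "compatible e xs ds" for ds
      using that by (induction e xs ds rule: compatible.induct) auto
    then show ?thesis
      using dead[OF e] sat_sweep[OF _ e xs p] sweep_defined by metis
  qed
  also have "\<dots> \<longleftrightarrow> feasible rows"
    using Suc sweep_proper[OF _ e xs p] by (auto simp: rows feasible_simps)
  finally show ?case by simp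
qed

end

text \<open>The work symbols name the subsets of \<open>D\<close> and the relations on
  \<open>D\<close> that are full or partial bijections: a finite supply, closed under
  elimination.\<close>

theorem polynomial_time_csp:
  fixes D :: "'d set" and R :: "'a \<Rightarrow> ('d \<times> 'd) set"
  assumes "finite A" "sep \<in> A" "finite D"
    and R: "\<And>l. l \<in> A - {sep} \<Longrightarrow> R l \<subseteq> D \<times> D \<and> (R l = D \<times> D \<or> partial_bij (R l))"
  shows "polynomial_time A
    {w. \<exists>rows ds. rows \<in> lists ({sep} \<times> lists (A - {sep})) \<and> rev w = flat rows \<and> sat (\<lambda>_. D) R rows ds}"
    (is "polynomial_time A ?L")
proof -
  define \<U> where "\<U> = Pow D"
  define \<V> where "\<V> = {V. V \<subseteq> D \<times> D \<and> (V = D \<times> D \<or> partial_bij V)}"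
  have fin: "finite \<U>" "finite \<V>" using assms(3) by (simp_all add: \<U>_def \<V>_def)
  have cnt: "countable \<U>" "countable \<V>" using fin by (auto intro: countable_finite)
  \<comment> \<open>Even numbers name subsets and odd ones relations, so that \<open>Sd\<close> and
    \<open>So\<close> are disjoint. The input separator will stand for \<open>D\<close>, no
    restriction.\<close>
  define cu :: "'d set \<Rightarrow> 'a symbol" where "cu U = Work (2 * to_nat_on \<U> U)" for U
  define cr :: "('d \<times> 'd) set \<Rightarrow> 'a symbol" where "cr V = Work (2 * to_nat_on \<V> V + 1)" for V
  define du :: "'a symbol \<Rightarrow> 'd set" where "du s = (case s of Work k \<Rightarrow> from_nat_into \<U> (k div 2) | _ \<Rightarrow> D)" for s
  define dr where "dr s = (case s of Work k \<Rightarrow> from_nat_into \<V> (k div 2) | Letter l \<Rightarrow> R l | Blank \<Rightarrow> {})" for s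
  define Sd where "Sd = insert (Letter sep) (cu ` \<U>)"
  define So where "So = Letter ` (A - {sep}) \<union> cr ` \<V>"
  define ud where "ud e y e' = cu {x \<in> du e'. \<exists>d \<in> du e. (x, d) \<in> dr y}" for e y e'
  define uo where "uo e y b a = cr (if dr y = D \<times> D \<or> dr b = D \<times> D then dr a
       else {(x', x) \<in> dr a. \<exists>d \<in> du e. (x', d) \<in> dr b \<and> (x, d) \<in> dr y})" for e y b a
  have du_cu [simp]: "du (cu U) = U" if "U \<in> \<U>" for U using that cnt by (simp add: du_def cu_def)
  have dr_cr [simp]: "dr (cr V) = V" if "V \<in> \<V>" for V using that cnt by (simp add: dr_def cr_def)
  have duU: "du e \<in> \<U>" if "e \<in> Sd" for e
    using that unfolding Sd_def by (auto, auto simp: du_def \<U>_def)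
  have drV: "dr y \<in> \<V>" if y: "y \<in> So" for y
  proof (cases "y \<in> cr ` \<V>")
    case False
    then obtain l where l: "y = Letter l" "l \<in> A - {sep}" using y by (auto simp: So_def)
    then show ?thesis using R[OF l(2)] by (simp add: dr_def \<V>_def)
  qed auto
  have ud_in: "{x \<in> du e'. \<exists>d \<in> du e. (x, d) \<in> dr y} \<in> \<U>" if "e' \<in> Sd" for e e' y
    using duU[OF that] by (auto simp: \<U>_def)
  \<comment> \<open>The composition through the eliminated vertex is a partial bijection, hence so
    is its intersection with \<open>dr a\<close>, even when \<open>dr a\<close> is full.\<close>
  have uo_in: "(if dr y = D \<times> D \<or> dr b = D \<times> D then dr a
       else {(x', x) \<in> dr a. \<exists>d \<in> du e. (x', d) \<in> dr b \<and> (x, d) \<in> dr y}) \<in> \<V>" (is "?V \<in> \<V>")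
    if "y \<in> So" "b \<in> So" "a \<in> So" for e y b a
  proof (cases "dr y = D \<times> D \<or> dr b = D \<times> D")
    case True
    then show ?thesis using drV[OF that(3)] by simp
  next
    case False
    then have pb: "partial_bij (dr y)" "partial_bij (dr b)" using drV that by (auto simp: \<V>_def)
    have "partial_bij {(x', x) \<in> dr a. \<exists>d \<in> du e. (x', d) \<in> dr b \<and> (x, d) \<in> dr y}"
      using pb unfolding partial_bij_def single_valued_def by blast
    then show ?thesis using False drV[OF that(3)] by (auto simp: \<V>_def)
  qed
  interpret csp_elimination Sd So "\<lambda>e. du e = {}" ud uo D du dr
  proof
    show "finite Sd" "finite So" using assms fin by (auto simp: Sd_def So_def)
    show "Sd \<inter> So = {}" by (auto simp: Sd_def So_def cu_def cr_def) presburger+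
    show "Blank \<notin> Sd" "Blank \<notin> So" by (auto simp: Sd_def So_def cu_def cr_def)
    show "ud e y e' \<in> Sd" if "e' \<in> Sd" for e y e' using ud_in[OF that] by (auto simp: ud_def Sd_def)
    show "uo e y b a \<in> So" if "y \<in> So" "b \<in> So" "a \<in> So" for e y b a
      using uo_in[OF that, of e] unfolding uo_def So_def by blast
    show "du e \<subseteq> D" if "e \<in> Sd" for e using duU[OF that] by (simp add: \<U>_def)
    show "dr y = D \<times> D \<or> partial_bij (dr y)" if "y \<in> So" for y using drV[OF that] by (simp add: \<V>_def)
    show "du (ud e y e') = {x \<in> du e'. \<exists>d \<in> du e. (x, d) \<in> dr y}" if "e' \<in> Sd" for e y e'
      using ud_in[OF that] by (simp add: ud_def)
    show "dr (uo e y b a) = (if dr y = D \<times> D \<or> dr b = D \<times> D then dr a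
       else {(x', x) \<in> dr a. \<exists>d \<in> du e. (x', d) \<in> dr b \<and> (x, d) \<in> dr y})"
      if "y \<in> So" "b \<in> So" "a \<in> So" for e y b a
      using dr_cr[OF uo_in[OF that, of e]] unfolding uo_def .
  qed simp
  let ?m = "map (map_prod Letter (map Letter))"
  have dudr: "du \<circ> Letter = (\<lambda>_. D)" "dr \<circ> Letter = R" by (auto simp: du_def dr_def)
  have flat_m: "flat (?m rows) = map Letter (flat rows)" for rows :: "('a \<times> 'a list) list"
    by (induction rows) auto
  have proper_m: "proper_rows (?m rows)" if "rows \<in> lists ({sep} \<times> lists (A - {sep}))" for rows
  proof -
    have "Letter sep \<in> Sd" "\<And>l. l \<in> A - {sep} \<Longrightarrow> Letter l \<in> So" by (auto simp: Sd_def So_def)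
    then show ?thesis using that by (induction rows) auto
  qed
  \<comment> \<open>The input contains no work symbols, so its parse into symbols comes from a parse
    into letters.\<close>
  have lift: "\<exists>rows'. rows = ?m rows' \<and> v = flat rows' \<and> rows' \<in> lists ({sep} \<times> lists (A - {sep}))"
    if "map Letter v = flat rows" "proper_rows rows" "v \<in> lists A" for v rows
    using that
  proof (induction rows arbitrary: v)
    case Nil
    then show ?case by (intro exI[of _ "[]"]) auto
  next
    case (Cons row rows)
    obtain e xs where row: "row = (e, xs)" by (cases row)
    have m: "map Letter v = e # xs @ flat rows" using Cons.prems by (simp add: row)
    then obtain l v1 v2 where v: "v = l # v1 @ v2" "e = Letter l" "xs = map Letter v1" "map Letter v2 = flat rows"
      by (auto simp: map_eq_Cons_conv map_eq_append_conv)
    have "e \<in> Sd" "set xs \<subseteq> So" using Cons.prems(2) by (auto simp: row)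
    then have "l = sep" "v1 \<in> lists (A - {sep})"
      using v(2,3) by (auto simp: Sd_def cu_def So_def cr_def)
    moreover obtain rows' where "rows = ?m rows'" "v2 = flat rows'" "rows' \<in> lists ({sep} \<times> lists (A - {sep}))"
      using Cons.IH[OF v(4)] Cons.prems v(1) by (auto simp: row)
    ultimately show ?case using v by (intro exI[of _ "(sep, v1) # rows'"]) (auto simp: row)
  qed
  have LA: "w \<in> lists A" if wL: "w \<in> ?L" for w
  proof -
    obtain rows where rows: "rows \<in> lists ({sep} \<times> lists (A - {sep}))" and w: "rev w = flat rows"
      using wL by blast
    from rows have "flat rows \<in> lists A" by (induction rows) (use assms(2) in auto)
    then show ?thesis unfolding w[symmetric] by auto
  qed
  have "{w \<in> lists A. \<exists>rows. proper_rows rows \<and> rev (map Letter w) = flat rows \<and> feasible rows} = ?L" (is "?K = _")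
  proof (intro equalityI subsetI)
    fix w assume "w \<in> ?K"
    then obtain rows where r: "w \<in> lists A" "proper_rows rows" "map Letter (rev w) = flat rows" "feasible rows"
      by (auto simp: rev_map)
    have "rev w \<in> lists A" using r(1) by auto
    then obtain rows' where r': "rows = ?m rows'" "rev w = flat rows'" "rows' \<in> lists ({sep} \<times> lists (A - {sep}))"
      using lift[OF r(3,2)] by blast
    have "\<exists>ds. sat (\<lambda>_. D) R rows' ds"
      using feasible_iff_sat[OF r(2)] r(4) by (simp add: r'(1) sat_map dudr)
    then show "w \<in> ?L" using r' by blast
  next
    fix w assume w: "w \<in> ?L"
    then obtain rows ds where r: "rows \<in> lists ({sep} \<times> lists (A - {sep}))" "rev w = flat rows" "sat (\<lambda>_. D) R rows ds"
      by blast
    have "feasible (?m rows)"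
      using feasible_iff_sat[OF proper_m[OF r(1)]] r(3) by (auto simp: sat_map dudr)
    moreover have "rev (map Letter w) = flat (?m rows)" by (simp add: flat_m rev_map r(2)[symmetric])
    ultimately show "w \<in> ?K" using LA[OF w] proper_m[OF r(1)] by blast
  qed
  moreover have "Letter ` A \<subseteq> Sd \<union> So" by (auto simp: Sd_def So_def)
  ultimately show ?thesis using polynomial_time_feasible[OF assms(1)] by simp
qed

section \<open>Switching modulo commutators\<close>

text \<open>\<open>X\<close> holds the letters of adjacent pairs, \<open>T\<close> the effects of
  switches on an incident letter, and \<open>flip\<close> reads a pair in the other order. Inverses
  are asked for on \<open>X\<close> only, since labels lie in \<open>insert null X\<close>.\<close>

locale switching =
  fixes X :: "'a set" and T :: "('a \<Rightarrow> 'a) set" and null :: 'a and flip :: "'a \<Rightarrow> 'a"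
  assumes id_T: "id \<in> T"
    and comp_T: "s \<in> T \<Longrightarrow> t \<in> T \<Longrightarrow> s \<circ> t \<in> T"
    and T_X: "t \<in> T \<Longrightarrow> y \<in> X \<Longrightarrow> t y \<in> X"
    and inverse_T: "t \<in> T \<Longrightarrow> \<exists>t' \<in> T. \<forall>y \<in> X. t' (t y) = y \<and> t (t' y) = y"
    and null_X: "null \<notin> X"
    and T_null: "t \<in> T \<Longrightarrow> t null = null"
    and flip_X: "y \<in> X \<Longrightarrow> flip y \<in> X"
    and flip_flip [simp]: "flip (flip y) = y"
    and flip_null: "flip null = null"
    and T_flip: "t \<in> T \<Longrightarrow> t (flip y) = flip (t y)"
begin

text \<open>The commutator of \<open>h\<close> and \<open>g\<close> sends \<open>g (h y)\<close> to
  \<open>h (g y)\<close>; in this form its orbits need no inverse maps.\<close>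

definition swaps :: "('a \<times> 'a) set" where
  "swaps = {(g (h y), h (g y)) | g h y. g \<in> T \<and> h \<in> T \<and> y \<in> X}"

text \<open>The equivalence relation of lying in the same orbit of the commutator subgroup.\<close>

definition eqv :: "'a \<Rightarrow> 'a \<Rightarrow> bool" (infix "\<asymp>" 50) where
  "y \<asymp> z \<longleftrightarrow> (y, z) \<in> swaps\<^sup>*"

lemma eqv_refl [simp]: "y \<asymp> y"
  by (simp add: eqv_def)

lemma eqv_trans [trans]: "a \<asymp> b \<Longrightarrow> b \<asymp> c \<Longrightarrow> a \<asymp> c"
  by (simp add: eqv_def)

lemma eqv_sym: "y \<asymp> z \<Longrightarrow> z \<asymp> y"
proof -
  have "sym swaps" unfolding sym_def swaps_def by blast
  then show "y \<asymp> z \<Longrightarrow> z \<asymp> y" unfolding eqv_def by (meson symD sym_rtrancl)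
qed

lemma eqv_commute: "g \<in> T \<Longrightarrow> h \<in> T \<Longrightarrow> y \<in> X \<Longrightarrow> g (h y) \<asymp> h (g y)"
  unfolding eqv_def swaps_def by blast

text \<open>Normality of the commutator subgroup: \<open>t\<close> moves inside past two maps, these
  are swapped, and \<open>t\<close> moves out again, each time by a single swap.\<close>

lemma eqv_apply:
  assumes "t \<in> T" "y \<asymp> z"
  shows "t y \<asymp> t z"
  using assms(2) unfolding eqv_def
proof (induction rule: rtrancl_induct)
  case (step b c)
  then obtain g h k where k: "g \<in> T" "h \<in> T" "k \<in> X" "b = g (h k)" "c = h (g k)"
    unfolding swaps_def by blast
  have "t b \<asymp> g (h (t k))" using eqv_commute[OF assms(1) comp_T[OF k(1,2)] k(3)] by (simp add: k)
  also have "g (h (t k)) \<asymp> h (g (t k))" using eqv_commute k T_X[OF assms(1)] by blast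
  also have "h (g (t k)) \<asymp> t c" using eqv_commute[OF comp_T[OF k(2,1)] assms(1) k(3)] by (simp add: k)
  finally show ?case using step.IH unfolding eqv_def by simp
qed simp

lemma eqv_flip:
  assumes "y \<asymp> z"
  shows "flip y \<asymp> flip z"
  using assms unfolding eqv_def
proof (induction rule: rtrancl_induct)
  case (step b c)
  then obtain g h k where k: "g \<in> T" "h \<in> T" "k \<in> X" "b = g (h k)" "c = h (g k)"
    unfolding swaps_def by blast
  then have "flip b \<asymp> flip c"
    using eqv_commute[OF k(1,2) flip_X[OF k(3)]] by (simp add: T_flip)
  then show ?case using step.IH unfolding eqv_def by simp
qed simp

lemma eqv_X: "y \<asymp> z \<Longrightarrow> y \<in> X \<Longrightarrow> z \<in> X"
  unfolding eqv_def by (induction rule: rtrancl_induct) (auto simp: swaps_def T_X)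

lemma eqv_cancel:
  assumes "t \<in> T" "t y \<asymp> t z" "y \<in> X" "z \<in> X"
  shows "y \<asymp> z"
  using inverse_T[OF assms(1)] eqv_apply[OF _ assms(2)] assms(3,4) by metis

section \<open>Labellings and their potentials under switching\<close>

definition switch :: "'v \<Rightarrow> ('a \<Rightarrow> 'a) \<Rightarrow> ('v \<Rightarrow> 'v \<Rightarrow> 'a) \<Rightarrow> 'v \<Rightarrow> 'v \<Rightarrow> 'a" where
  "switch w t l = (\<lambda>u v. if w = u \<or> w = v then t (l u v) else l u v)"

definition labelling :: "('v \<Rightarrow> 'v \<Rightarrow> 'a) \<Rightarrow> bool" where
  "labelling l \<longleftrightarrow> (\<forall>u v. l u v \<in> insert null X \<and> l v u = flip (l u v) \<and> l u u = null)"

inductive reach :: "'v set \<Rightarrow> ('v \<Rightarrow> 'v \<Rightarrow> 'a) \<Rightarrow> ('v \<Rightarrow> 'v \<Rightarrow> 'a) \<Rightarrow> bool" for V l where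
  reach_refl: "reach V l l"
| reach_step: "reach V l l' \<Longrightarrow> w \<in> V \<Longrightarrow> t \<in> T \<Longrightarrow> reach V l (switch w t l')"

text \<open>A potential \<open>s\<close> together with a bipartition \<open>\<sigma>\<close> witnesses that all labels can be switched to \<open>x\<close>
  modulo commutators.\<close>

definition potential :: "'v set \<Rightarrow> ('v \<Rightarrow> 'v \<Rightarrow> 'a) \<Rightarrow> 'a \<Rightarrow> ('v \<Rightarrow> bool) \<Rightarrow> ('v \<Rightarrow> 'a \<Rightarrow> 'a) \<Rightarrow> bool" where
  "potential V l x \<sigma> s \<longleftrightarrow> s ` V \<subseteq> T \<and>
     (\<forall>u \<in> V. \<forall>v \<in> V. l u v \<noteq> null \<longrightarrow> \<sigma> u \<noteq> \<sigma> v \<and> (\<sigma> u \<longrightarrow> l u v \<asymp> s u (s v x)))"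

lemma labellingD:
  assumes "labelling l"
  shows "l u v \<noteq> null \<Longrightarrow> l u v \<in> X" "l v u = flip (l u v)" "l u u = null"
  using assms unfolding labelling_def by blast+

lemma labelling_null_commute: "labelling l \<Longrightarrow> l v u = null \<longleftrightarrow> l u v = null"
  by (metis flip_null labellingD(2))

lemma T_eq_null: "t \<in> T \<Longrightarrow> labelling l \<Longrightarrow> t (l u v) = null \<longleftrightarrow> l u v = null"
  using labellingD(1)[of l u v] T_X[of t "l u v"] T_null[of t] null_X by auto

lemma labelling_switch:
  assumes "labelling l" "t \<in> T"
  shows "labelling (switch w t l)"
  unfolding labelling_def
proof (intro allI conjI)
  fix u v
  note l = labellingD(1,2)[OF assms(1), of u v] labellingD(3)[OF assms(1), of u]
  show "switch w t l u v \<in> insert null X"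
    using l(1) assms(2) by (cases "l u v = null") (auto simp: switch_def T_null T_X)
  show "switch w t l v u = flip (switch w t l u v)"
    using l(2) assms(2) by (auto simp: switch_def T_flip)
  show "switch w t l u u = null"
    using l(3) assms(2) by (auto simp: switch_def T_null)
qed

lemma labelling_reach: "reach V l l' \<Longrightarrow> labelling l \<Longrightarrow> labelling l'"
  by (induction rule: reach.induct) (auto simp: labelling_switch)

lemma reach_null: "reach V l l' \<Longrightarrow> labelling l \<Longrightarrow> l' u v = null \<longleftrightarrow> l u v = null"
proof (induction rule: reach.induct)
  case (reach_step l' w t)
  then show ?case using T_eq_null[OF reach_step(3) labelling_reach[OF reach_step(1,5)], of u v]
    by (simp add: switch_def)
qed simp

lemma switch_inverse:
  assumes "labelling l" "t \<in> T" "t' \<in> T" "\<forall>y \<in> X. t' (t y) = y"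
  shows "switch w t' (switch w t l) = l"
proof (intro ext)
  fix u v
  show "switch w t' (switch w t l) u v = l u v"
    using assms labellingD(1)[OF assms(1), of u v]
    by (cases "l u v = null") (auto simp: switch_def T_null)
qed

lemma reach_trans: "reach V l' l'' \<Longrightarrow> reach V l l' \<Longrightarrow> reach V l l''"
  by (induction rule: reach.induct) (auto intro: reach_step)

text \<open>The switch is absorbed by the potential at \<open>w\<close>. If \<open>w\<close> is the
  second end of a pair, \<open>t\<close> has to pass \<open>s u\<close>, which is possible only
  modulo commutators.\<close>

lemma potential_switch:
  assumes "labelling l" "x \<in> X" "potential V l x \<sigma> s" "t \<in> T" "w \<in> V"
  shows "potential V (switch w t l) x \<sigma> (s(w := t \<circ> s w))"
  unfolding potential_def
proof (intro conjI ballI impI)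
  show "(s(w := t \<circ> s w)) ` V \<subseteq> T" using assms by (auto simp: potential_def comp_T)
next
  fix u v assume uv: "u \<in> V" "v \<in> V" "switch w t l u v \<noteq> null"
  then have "l u v \<noteq> null" using assms T_null by (auto simp: switch_def split: if_splits)
  then have p: "\<sigma> u \<noteq> \<sigma> v" "\<sigma> u \<Longrightarrow> l u v \<asymp> s u (s v x)" "s u \<in> T" "s v \<in> T"
    using assms(3) uv unfolding potential_def by auto
  then show "\<sigma> u \<noteq> \<sigma> v" by simp
  assume "\<sigma> u"
  then have l: "l u v \<asymp> s u (s v x)" and "u \<noteq> v" using p by auto
  have u: "t (l u v) \<asymp> t (s u (s v x))" using eqv_apply[OF assms(4) l] .
  have "t (s u (s v x)) \<asymp> s u (t (s v x))" using eqv_commute assms(2,4) p(3,4) T_X by blast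
  then have "t (l u v) \<asymp> s u (t (s v x))" using u eqv_trans by blast
  then show "switch w t l u v \<asymp> (s(w := t \<circ> s w)) u ((s(w := t \<circ> s w)) v x)"
    using l u \<open>u \<noteq> v\<close> by (auto simp: switch_def)
qed

lemma potential_reach:
  assumes "reach V l l'" "labelling l" "x \<in> X" "potential V l' x \<sigma> s"
  shows "\<exists>s. potential V l x \<sigma> s"
  using assms
proof (induction arbitrary: s rule: reach.induct)
  case (reach_step l' w t)
  obtain t' where t': "t' \<in> T" "\<forall>y \<in> X. t' (t y) = y" using inverse_T reach_step by blast
  have l': "labelling l'" using labelling_reach reach_step by blast
  have "potential V (switch w t' (switch w t l')) x \<sigma> (s(w := t' \<circ> s w))"
    using potential_switch[OF labelling_switch[OF l' reach_step(3)] reach_step(6,7) t'(1) reach_step(2)]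
    by simp
  then have "potential V l' x \<sigma> (s(w := t' \<circ> s w))"
    using switch_inverse[OF l'] reach_step t' by simp
  then show ?case using reach_step by blast
qed blast

definition upd :: "'v \<Rightarrow> 'v \<Rightarrow> 'a \<Rightarrow> ('v \<Rightarrow> 'v \<Rightarrow> 'a) \<Rightarrow> 'v \<Rightarrow> 'v \<Rightarrow> 'a" where
  "upd u v z l = (\<lambda>a b. if a = u \<and> b = v then z else if a = v \<and> b = u then flip z else l a b)"

text \<open>Switching at \<open>u\<close> and \<open>v\<close> by the factors of a commutator affects the pair \<open>u\<close>, \<open>v\<close> only.\<close>

lemma reach_upd_swap:
  assumes "labelling l" "u \<in> V" "v \<in> V" "u \<noteq> v" "(l u v, z) \<in> swaps"
  shows "reach V l (upd u v z l)"
proof -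
  obtain g h k where k: "g \<in> T" "h \<in> T" "k \<in> X" "l u v = g (h k)" "z = h (g k)"
    using assms(5) unfolding swaps_def by blast
  obtain g' where g': "g' \<in> T" "\<And>y. y \<in> X \<Longrightarrow> g' (g y) = y" "\<And>y. y \<in> X \<Longrightarrow> g (g' y) = y"
    using inverse_T[OF k(1)] by blast
  obtain h' where h': "h' \<in> T" "\<And>y. y \<in> X \<Longrightarrow> h' (h y) = y" "\<And>y. y \<in> X \<Longrightarrow> h (h' y) = y"
    using inverse_T[OF k(2)] by blast
  have "switch v h (switch u g (switch v h' (switch u g' l))) = upd u v z l"
  proof (intro ext)
    fix a b
    have z: "h (g (h' (g' (l u v)))) = z" using k g' h' T_X by simp
    have "l v u = flip (l u v)" using labellingD[OF assms(1)] by blast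
    then have fz: "h (g (h' (g' (l v u)))) = flip z"
      using T_flip[OF k(1)] T_flip[OF k(2)] T_flip[OF g'(1)] T_flip[OF h'(1)] z by simp
    have "g (g' (l a b)) = l a b" "h (h' (l a b)) = l a b"
      using labellingD(1)[OF assms(1), of a b] g' h' k(1,2)
        T_null[OF k(1)] T_null[OF k(2)] T_null[OF g'(1)] T_null[OF h'(1)]
      by (cases "l a b = null"; simp)+
    then show "switch v h (switch u g (switch v h' (switch u g' l))) a b = upd u v z l a b"
      using z fz assms(4) by (auto simp: switch_def upd_def)
  qed
  moreover have "reach V l (switch v h (switch u g (switch v h' (switch u g' l))))"
    using assms k g' h' by (intro reach_step reach_refl)
  ultimately show ?thesis by simp
qed

lemma labelling_upd:
  assumes "labelling l" "u \<noteq> v" "z \<in> X"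
  shows "labelling (upd u v z l)"
  unfolding labelling_def
proof (intro allI conjI)
  fix a b
  note l = labellingD(1,2)[OF assms(1), of a b] labellingD(3)[OF assms(1), of a]
  show "upd u v z l a b \<in> insert null X" using l(1) assms(3) by (auto simp: upd_def flip_X)
  show "upd u v z l b a = flip (upd u v z l a b)" using l(2) assms(2) by (auto simp: upd_def flip_flip)
  show "upd u v z l a a = null" using l(3) assms(2) by (auto simp: upd_def)
qed

lemma reach_upd:
  assumes "labelling l" "u \<in> V" "v \<in> V" "l u v \<noteq> null" "l u v \<asymp> z"
  shows "reach V l (upd u v z l)"
proof -
  have uv: "u \<noteq> v" and X: "l u v \<in> X" using labellingD[OF assms(1)] assms(4) by metis+
  show ?thesis
    using assms(5) unfolding eqv_def
  proof (induction rule: rtrancl_induct)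
    case base
    have "upd u v (l u v) l = l"
      using labellingD(2)[OF assms(1), of v u] by (auto simp: upd_def fun_eq_iff)
    then show ?case by (simp add: reach_refl)
  next
    case (step b c)
    have "b \<in> X" using eqv_X step.hyps(1) X unfolding eqv_def by blast
    then have "reach V (upd u v b l) (upd u v c (upd u v b l))"
      using assms uv step.hyps(2) by (intro reach_upd_swap labelling_upd) (auto simp: upd_def)
    moreover have "upd u v c (upd u v b l) = upd u v c l" by (auto simp: upd_def fun_eq_iff)
    ultimately show ?case using reach_trans step.IH by metis
  qed
qed

text \<open>Switching each vertex by the inverse of its potential makes all labels read from the
  side \<sigma> equivalent to \<open>x\<close>. Commutators then turn equivalence into equality, one
  pair after the other.\<close>

lemma reach_constant:
  assumes "finite V" "labelling l" "x \<in> X" "potential V l x \<sigma> s"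
  shows "\<exists>l'. reach V l l' \<and>
    (\<forall>u \<in> V. \<forall>v \<in> V. l' u v \<noteq> null \<longrightarrow> \<sigma> u \<noteq> \<sigma> v \<and> (\<sigma> u \<longrightarrow> l' u v = x))"
proof -
  have "\<exists>l' s'. reach V l l' \<and> potential V l' x \<sigma> s' \<and> (\<forall>w \<in> W. \<forall>y \<in> X. s' w y = y)"
    if "finite W" "W \<subseteq> V" for W
    using that
  proof (induction W rule: finite_induct)
    case empty
    then show ?case using assms reach_refl by blast
  next
    case (insert w W)
    then obtain l' s' where IH: "reach V l l'" "potential V l' x \<sigma> s'" "\<forall>w \<in> W. \<forall>y \<in> X. s' w y = y"
      by auto
    have "s' w \<in> T" using IH(2) insert.prems by (auto simp: potential_def)
    then obtain t where t: "t \<in> T" "\<forall>y \<in> X. t (s' w y) = y" using inverse_T by blast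
    have "reach V l (switch w t l')" using IH(1) t insert.prems by (auto intro: reach_step)
    moreover have "potential V (switch w t l') x \<sigma> (s'(w := t \<circ> s' w))"
      using potential_switch[OF labelling_reach[OF IH(1) assms(2)] assms(3) IH(2) t(1)] insert.prems by blast
    moreover have "\<forall>a \<in> insert w W. \<forall>y \<in> X. (s'(w := t \<circ> s' w)) a y = y" using t(2) IH(3) by auto
    ultimately show ?case by blast
  qed
  from this[OF assms(1) order.refl] obtain l1 s1 where
    l1: "reach V l l1" "potential V l1 x \<sigma> s1" "\<forall>w \<in> V. \<forall>y \<in> X. s1 w y = y" by blast
  then have l1_x: "\<forall>u \<in> V. \<forall>v \<in> V. l1 u v \<noteq> null \<longrightarrow> \<sigma> u \<noteq> \<sigma> v \<and> (\<sigma> u \<longrightarrow> l1 u v \<asymp> x)"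
    using assms(3) unfolding potential_def by simp
  \<comment> \<open>\<open>F\<close> collects the pairs already treated. Treating a further pair
    changes the label of no other pair and so keeps what was achieved.\<close>
  define ok where "ok F l' u v \<longleftrightarrow> (l' u v \<noteq> null \<longrightarrow>
      \<sigma> u \<noteq> \<sigma> v \<and> (\<sigma> u \<longrightarrow> l' u v \<asymp> x \<and> ((u, v) \<in> F \<longrightarrow> l' u v = x)))" for F l' u v
  have "\<exists>l'. reach V l l' \<and> (\<forall>u \<in> V. \<forall>v \<in> V. ok F l' u v)"
    if "finite F" "F \<subseteq> V \<times> V" for F
    using that
  proof (induction F rule: finite_induct)
    case empty
    then show ?case using l1(1) l1_x unfolding ok_def by blast
  next
    case (insert e F)
    obtain u v where e: "e = (u, v)" "u \<in> V" "v \<in> V" using insert.prems by auto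
    obtain l' where IH: "reach V l l'" "\<And>u v. u \<in> V \<Longrightarrow> v \<in> V \<Longrightarrow> ok F l' u v"
      using insert by auto
    note lab = labelling_reach[OF IH(1) assms(2)]
    show ?case
    proof (cases "\<sigma> u \<and> l' u v \<noteq> null")
      case False
      have "ok (insert e F) l' a b" if "a \<in> V" "b \<in> V" for a b
        using IH(2)[OF that] False by (auto simp: ok_def e)
      then show ?thesis using IH(1) by blast
    next
      case True
      have uv: "\<not> \<sigma> v" "l' u v \<asymp> x" "l' v u \<noteq> null"
        using True IH(2)[OF e(2,3)] labelling_null_commute[OF lab] by (auto simp: ok_def)
      have "reach V l (upd u v x l')"
        using reach_trans[OF reach_upd[OF lab e(2,3) _ uv(2)] IH(1)] True by blast
      moreover have "ok (insert e F) (upd u v x l') a b" if "a \<in> V" "b \<in> V" for a b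
        using IH(2)[OF that] True uv by (auto simp: ok_def e upd_def)
      ultimately show ?thesis by blast
    qed
  qed
  from this[of "V \<times> V"] assms(1) show ?thesis by (auto simp: ok_def)
qed

lemma potential_pullback:
  assumes "potential V l x \<sigma> s" "h ` V' \<subseteq> V" "\<forall>u \<in> V'. \<forall>v \<in> V'. l' u v \<noteq> null \<longrightarrow> l (h u) (h v) = l' u v"
  shows "potential V' l' x (\<sigma> \<circ> h) (s \<circ> h)"
  using assms unfolding potential_def image_subset_iff comp_def by metis

text \<open>Every pair is read from its other end; commuting the two potentials restores their
  order.\<close>

lemma potential_flip:
  assumes "labelling l" "x \<in> X" "potential V l x \<sigma> s"
  shows "potential V l (flip x) (\<lambda>u. \<not> \<sigma> u) s"
  unfolding potential_def
proof (intro conjI ballI impI)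
  show "s ` V \<subseteq> T" using assms(3) by (simp add: potential_def)
next
  fix u v assume uv: "u \<in> V" "v \<in> V" "l u v \<noteq> null"
  then show "(\<not> \<sigma> u) \<noteq> (\<not> \<sigma> v)" using assms(3) unfolding potential_def by blast
  assume "\<not> \<sigma> u"
  have T: "s u \<in> T" "s v \<in> T" using assms(3) uv by (auto simp: potential_def)
  have "l v u \<noteq> null" using uv labelling_null_commute[OF assms(1)] by blast
  then have "l v u \<asymp> s v (s u x)" using assms(3) uv \<open>\<not> \<sigma> u\<close> unfolding potential_def by blast
  then have "flip (l v u) \<asymp> flip (s v (s u x))" by (rule eqv_flip)
  also have "flip (s v (s u x)) = s v (s u (flip x))" using T_flip[OF T(1)] T_flip[OF T(2)] by simp
  also have "\<dots> \<asymp> s u (s v (flip x))" using eqv_commute T flip_X assms(2) by blast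
  finally show "l u v \<asymp> s u (s v (flip x))" using labellingD(2)[OF assms(1), of v u] by simp
qed

text \<open>The reference letter coming from a two-vertex target is exchanged for a letter of the
  labelling itself: if \<open>t\<close> undoes \<open>s a\<close> and \<open>s b\<close>, then
  \<open>x\<close> is equivalent to \<open>t (l a b)\<close>.\<close>

lemma potential_rebase:
  assumes "labelling l" "x \<in> X" "potential V l x \<sigma> s" "a \<in> V" "b \<in> V" "l a b \<noteq> null"
  shows "\<exists>\<sigma> s. potential V l (l a b) \<sigma> s"
proof -
  have main: "\<exists>\<sigma> s. potential V l (l a b) \<sigma> s" if x: "x \<in> X" and p: "potential V l x \<sigma> s" and "\<sigma> a" for x \<sigma> s
  proof -
    have T: "s u \<in> T" if "u \<in> V" for u using p that by (auto simp: potential_def)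
    have ab: "l a b \<asymp> s a (s b x)" using p assms \<open>\<sigma> a\<close> unfolding potential_def by blast
    obtain t where t: "t \<in> T" "\<forall>y \<in> X. t ((s a \<circ> s b) y) = y"
      using inverse_T[OF comp_T[OF T[OF assms(4)] T[OF assms(5)]]] by blast
    then have tab: "t (l a b) \<asymp> x" using eqv_apply[OF t(1) ab] x by simp
    have abX: "l a b \<in> X" using labellingD(1)[OF assms(1)] assms(6) by blast
    \<comment> \<open>Each adjacent pair has exactly one end on the side \<sigma>, so putting
      \<open>t\<close> on this side inserts it once per pair.\<close>
    let ?s = "\<lambda>u. if \<sigma> u then s u \<circ> t else s u"
    have "potential V l (l a b) \<sigma> ?s"
      unfolding potential_def
    proof (intro conjI ballI impI)
      show "?s ` V \<subseteq> T" using T t comp_T by auto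
    next
      fix u v assume uv: "u \<in> V" "v \<in> V" "l u v \<noteq> null"
      then show "\<sigma> u \<noteq> \<sigma> v" using p unfolding potential_def by blast
      assume "\<sigma> u"
      then have "\<not> \<sigma> v" and l: "l u v \<asymp> s u (s v x)" using p uv unfolding potential_def by auto
      have "s u (s v (t (l a b))) \<asymp> s u (s v x)" using eqv_apply T uv tab by blast
      moreover have "s u (t (s v (l a b))) \<asymp> s u (s v (t (l a b)))"
        using eqv_apply[OF T[OF uv(1)]] eqv_commute[OF t(1) T[OF uv(2)] abX] by blast
      ultimately have "l u v \<asymp> s u (t (s v (l a b)))" using l eqv_sym eqv_trans by blast
      then show "l u v \<asymp> ?s u (?s v (l a b))" using \<open>\<sigma> u\<close> \<open>\<not> \<sigma> v\<close> by simp
    qed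
    then show ?thesis by blast
  qed
  show ?thesis
  proof (cases "\<sigma> a")
    case True
    then show ?thesis using main assms by blast
  next
    case False
    then show ?thesis using main[OF flip_X[OF assms(2)] potential_flip[OF assms(1-3)]] by blast
  qed
qed

section \<open>Potentials as solutions of binary constraints\<close>

definition eclass :: "'a \<Rightarrow> 'a set" where "eclass y = {z. y \<asymp> z}"

lemma eclass_eq_iff: "eclass y = eclass z \<longleftrightarrow> y \<asymp> z"
  unfolding eclass_def using eqv_sym eqv_trans eqv_refl by blast

text \<open>A value is the side of a vertex and the class of \<open>s u x\<close>. Only the class
  matters for a potential, and finiteness of \<open>X\<close> leaves finitely many.\<close>

definition vals :: "'a \<Rightarrow> (bool \<times> 'a set) set" where
  "vals x = UNIV \<times> (\<lambda>t. eclass (t x)) ` T"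

text \<open>The label is always read from the end on the side \<open>True\<close>, hence
  \<open>flip y\<close> if that is the second vertex.\<close>

definition constraint :: "'a \<Rightarrow> 'a \<Rightarrow> ((bool \<times> 'a set) \<times> (bool \<times> 'a set)) set" where
  "constraint x y = (if y = null then vals x \<times> vals x else
     {((p, eclass (g x)), (q, eclass (h x))) | p q g h.
        g \<in> T \<and> h \<in> T \<and> p \<noteq> q \<and> (if p then y else flip y) \<asymp> g (h x)})"

lemma finite_vals: "finite X \<Longrightarrow> x \<in> X \<Longrightarrow> finite (vals x)"
proof -
  assume "finite X" "x \<in> X"
  then have "(\<lambda>t. eclass (t x)) ` T \<subseteq> eclass ` X" using T_X by blast
  then show "finite (vals x)" using \<open>finite X\<close> unfolding vals_def by (simp add: finite_subset)
qed

lemma constraint_subset: "constraint x y \<subseteq> vals x \<times> vals x"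
  by (auto simp: constraint_def vals_def)

lemma constraintI:
  "y \<noteq> null \<Longrightarrow> g \<in> T \<Longrightarrow> h \<in> T \<Longrightarrow> p \<noteq> q \<Longrightarrow> (if p then y else flip y) \<asymp> g (h x) \<Longrightarrow>
    ((p, eclass (g x)), (q, eclass (h x))) \<in> constraint x y"
  unfolding constraint_def by (simp only: if_False) blast

text \<open>Modulo commutators \<open>g'\<close> can be cancelled from
  \<open>g' (h' x) \<asymp> g' (h x)\<close>. So a label and the value at one end fix the value at
  the other.\<close>

lemma eqv_determined:
  assumes "x \<in> X" "g \<in> T" "h \<in> T" "g' \<in> T" "h' \<in> T" "y \<asymp> g (h x)" "y \<asymp> g' (h' x)" "g x \<asymp> g' x"
  shows "h x \<asymp> h' x"
proof -
  have "g' (h' x) \<asymp> g (h x)" using assms eqv_sym eqv_trans by blast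
  also have "g (h x) \<asymp> h (g x)" using eqv_commute assms by blast
  also have "h (g x) \<asymp> h (g' x)" using eqv_apply assms by blast
  also have "h (g' x) \<asymp> g' (h x)" using eqv_commute assms by blast
  finally show ?thesis using eqv_cancel[OF assms(4)] T_X assms eqv_sym by blast
qed

lemma partial_bij_constraint:
  assumes "x \<in> X" "y \<noteq> null"
  shows "partial_bij (constraint x y)"
proof -
  have c: "(d, e) \<in> constraint x y \<longleftrightarrow> (\<exists>g h. g \<in> T \<and> h \<in> T \<and> snd d = eclass (g x) \<and> snd e = eclass (h x)
      \<and> fst e = (\<not> fst d) \<and> (if fst d then y else flip y) \<asymp> g (h x))" for d e
    using assms(2) by (cases d; cases e) (auto simp: constraint_def)
  have "single_valued (constraint x y)"
  proof (rule single_valuedI)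
    fix d e e' assume "(d, e) \<in> constraint x y" "(d, e') \<in> constraint x y"
    then obtain g h g' h' where *: "g \<in> T" "h \<in> T" "snd d = eclass (g x)" "snd e = eclass (h x)"
      "fst e = (\<not> fst d)" "(if fst d then y else flip y) \<asymp> g (h x)"
      "g' \<in> T" "h' \<in> T" "snd d = eclass (g' x)" "snd e' = eclass (h' x)"
      "fst e' = (\<not> fst d)" "(if fst d then y else flip y) \<asymp> g' (h' x)"
      unfolding c by blast
    then have "g x \<asymp> g' x" using eclass_eq_iff by metis
    then have "h x \<asymp> h' x"
      using eqv_determined[OF assms(1) *(1,2,7,8) *(6,12)] by blast
    then show "e = e'" using *(4,5,10,11) eclass_eq_iff[of "h x" "h' x"] by (simp add: prod_eq_iff)
  qed
  moreover have "single_valued ((constraint x y)\<inverse>)"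
  proof (rule single_valuedI)
    fix d d' e assume "(e, d) \<in> (constraint x y)\<inverse>" "(e, d') \<in> (constraint x y)\<inverse>"
    then have "(d, e) \<in> constraint x y" "(d', e) \<in> constraint x y" by simp_all
    then obtain g h g' h' where *: "g \<in> T" "h \<in> T" "snd d = eclass (g x)" "snd e = eclass (h x)"
      "fst e = (\<not> fst d)" "(if fst d then y else flip y) \<asymp> g (h x)"
      "g' \<in> T" "h' \<in> T" "snd d' = eclass (g' x)" "snd e = eclass (h' x)"
      "fst e = (\<not> fst d')" "(if fst d' then y else flip y) \<asymp> g' (h' x)"
      unfolding c by blast
    then have fst: "fst d = fst d'" by simp
    \<comment> \<open>Exchanging the factors reduces the converse relation to the same
      lemma.\<close>
    have "g (h x) \<asymp> h (g x)" "g' (h' x) \<asymp> h' (g' x)"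
      using eqv_commute[OF *(1,2) assms(1)] eqv_commute[OF *(7,8) assms(1)] by blast+
    then have "(if fst d then y else flip y) \<asymp> h (g x)" "(if fst d then y else flip y) \<asymp> h' (g' x)"
      using eqv_trans[OF *(6)] eqv_trans[OF *(12)[folded fst]] by blast+
    moreover have "h x \<asymp> h' x" using *(4,10) eclass_eq_iff by metis
    ultimately have "g x \<asymp> g' x"
      using eqv_determined[OF assms(1) *(2,1,8,7)] by blast
    then show "d = d'" using *(3,9) fst eclass_eq_iff[of "g x" "g' x"] by (simp add: prod_eq_iff)
  qed
  ultimately show ?thesis by (simp add: partial_bij_def)
qed

text \<open>The matrix lists every pair once, so constraints are imposed for \<open>u < v\<close>
  only; the other order is recovered by \<open>flip\<close> and commutation.\<close>

lemma potential_iff_constraints: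
  fixes V :: "'v::linorder set"
  assumes "labelling l" "x \<in> X"
  shows "(\<exists>\<sigma> s. potential V l x \<sigma> s) \<longleftrightarrow>
    (\<exists>\<phi>. \<phi> ` V \<subseteq> vals x \<and> (\<forall>u \<in> V. \<forall>v \<in> V. u < v \<longrightarrow> (\<phi> u, \<phi> v) \<in> constraint x (l u v)))"
proof
  assume "\<exists>\<sigma> s. potential V l x \<sigma> s"
  then obtain \<sigma> s where p: "potential V l x \<sigma> s" by blast
  let ?\<phi> = "\<lambda>u. (\<sigma> u, eclass (s u x))"
  have T: "s u \<in> T" if "u \<in> V" for u using p that by (auto simp: potential_def)
  have vals: "?\<phi> ` V \<subseteq> vals x" using T by (auto simp: vals_def)
  have "(?\<phi> u, ?\<phi> v) \<in> constraint x (l u v)" if uv: "u \<in> V" "v \<in> V" for u v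
  proof (cases "l u v = null")
    case True
    then show ?thesis using vals uv by (auto simp: constraint_def)
  next
    case False
    then have ne: "\<sigma> u \<noteq> \<sigma> v" using p uv unfolding potential_def by blast
    have "(if \<sigma> u then l u v else flip (l u v)) \<asymp> s u (s v x)"
    proof (cases "\<sigma> u")
      case True
      then show ?thesis using p uv False unfolding potential_def by simp
    next
      case \<sigma>: False
      have "l v u \<noteq> null" using False labelling_null_commute[OF assms(1)] by blast
      then have "l v u \<asymp> s v (s u x)" using p uv ne \<sigma> unfolding potential_def by blast
      also have "s v (s u x) \<asymp> s u (s v x)" using eqv_commute T uv assms(2) by blast
      finally show ?thesis using \<sigma> labellingD(2)[OF assms(1), of u v] by simp
    qed
    then show ?thesis using constraintI False ne T uv by blast
  qed
  then show "\<exists>\<phi>. \<phi> ` V \<subseteq> vals x \<and> (\<forall>u \<in> V. \<forall>v \<in> V. u < v \<longrightarrow> (\<phi> u, \<phi> v) \<in> constraint x (l u v))"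
    using vals by blast
next
  assume "\<exists>\<phi>. \<phi> ` V \<subseteq> vals x \<and> (\<forall>u \<in> V. \<forall>v \<in> V. u < v \<longrightarrow> (\<phi> u, \<phi> v) \<in> constraint x (l u v))"
  then obtain \<phi> where \<phi>: "\<phi> ` V \<subseteq> vals x" "\<And>u v. u \<in> V \<Longrightarrow> v \<in> V \<Longrightarrow> u < v \<Longrightarrow> (\<phi> u, \<phi> v) \<in> constraint x (l u v)"
    by blast
  have "\<forall>u \<in> V. \<exists>t \<in> T. snd (\<phi> u) = eclass (t x)" using \<phi>(1) by (fastforce simp: vals_def)
  then obtain s where s: "\<And>u. u \<in> V \<Longrightarrow> s u \<in> T" "\<And>u. u \<in> V \<Longrightarrow> snd (\<phi> u) = eclass (s u x)"
    by metis
  let ?\<sigma> = "\<lambda>u. fst (\<phi> u)"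
  have less: "?\<sigma> u \<noteq> ?\<sigma> v \<and> (if ?\<sigma> u then l u v else flip (l u v)) \<asymp> s u (s v x)"
    if uv: "u \<in> V" "v \<in> V" "u < v" "l u v \<noteq> null" for u v
  proof -
    \<comment> \<open>These representatives belong to the pair; they are replaced by
      \<open>s u\<close> and \<open>s v\<close>, which are chosen once per vertex from the same
      classes.\<close>
    obtain g h where gh: "g \<in> T" "h \<in> T" "eclass (s u x) = eclass (g x)" "eclass (s v x) = eclass (h x)"
      "?\<sigma> u \<noteq> ?\<sigma> v" "(if ?\<sigma> u then l u v else flip (l u v)) \<asymp> g (h x)"
      using \<phi>(2)[OF uv(1-3)] uv(4) s(2)[OF uv(1)] s(2)[OF uv(2)] unfolding constraint_def by auto
    have "g (h x) \<asymp> g (s v x)" using eqv_apply gh eclass_eq_iff eqv_sym by metis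
    also have "g (s v x) \<asymp> s v (g x)" using eqv_commute gh s uv assms by blast
    also have "s v (g x) \<asymp> s v (s u x)" using eqv_apply gh eclass_eq_iff eqv_sym s uv by metis
    also have "s v (s u x) \<asymp> s u (s v x)" using eqv_commute s uv assms by blast
    finally have "g (h x) \<asymp> s u (s v x)" .
    then show ?thesis using gh eqv_trans by blast
  qed
  have "potential V l x ?\<sigma> s"
    unfolding potential_def
  proof (intro conjI ballI impI)
    show "s ` V \<subseteq> T" using s by blast
  next
    fix u v assume uv: "u \<in> V" "v \<in> V" "l u v \<noteq> null"
    then have "u \<noteq> v" using labellingD(3)[OF assms(1)] by blast
    have vu: "l v u \<noteq> null" "flip (l v u) = l u v"
      using uv labelling_null_commute[OF assms(1)] labellingD(2)[OF assms(1), of u v] by auto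
    show "?\<sigma> u \<noteq> ?\<sigma> v" using less[of u v] less[of v u] uv vu \<open>u \<noteq> v\<close> by (meson neqE)
    assume "?\<sigma> u"
    show "l u v \<asymp> s u (s v x)"
    proof (cases "u < v")
      case True
      then show ?thesis using less[of u v] uv \<open>?\<sigma> u\<close> by simp
    next
      case False
      then have "v < u" using \<open>u \<noteq> v\<close> by simp
      then have "l u v \<asymp> s v (s u x)" using less[of v u] uv vu \<open>?\<sigma> u\<close> by (auto split: if_splits)
      also have "s v (s u x) \<asymp> s u (s v x)" using eqv_commute s uv assms(2) by blast
      finally show ?thesis .
    qed
  qed
  then show "\<exists>\<sigma> s. potential V l x \<sigma> s" by blast
qed

end

section \<open>Mixed graphs as labellings\<close>

text \<open>\<open>adj_letter\<close> for vertices of any type, as needed for \<open>H\<close>.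
  \<open>ArcUp\<close> now means an arc from the first argument to the second.\<close>

definition pair_letter :: "'v mgraph \<Rightarrow> 'v \<Rightarrow> 'v \<Rightarrow> letter" where
  "pair_letter G u v =
     (if {u, v} \<in> edges G then EdgeCol (ecol G {u, v})
      else if (u, v) \<in> arcs G then ArcUp (acol G (u, v))
      else if (v, u) \<in> arcs G then ArcDown (acol G (v, u))
      else NotAdj)"

lemma adj_letter_eq: "adj_letter = pair_letter"
  by (intro ext) (simp add: adj_letter_def pair_letter_def)

fun act :: "switch \<Rightarrow> letter \<Rightarrow> letter" where
  "act (\<alpha>, \<beta>, \<gamma>) (EdgeCol i) = EdgeCol (\<alpha> i)"
| "act (\<alpha>, \<beta>, \<gamma>) (ArcUp i) = (if \<gamma> i 1 = 1 then ArcUp (\<beta> i) else ArcDown (\<beta> i))"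
| "act (\<alpha>, \<beta>, \<gamma>) (ArcDown i) = (if \<gamma> i 1 = 1 then ArcDown (\<beta> i) else ArcUp (\<beta> i))"
| "act \<pi> NotAdj = NotAdj"
| "act \<pi> EndRow = EndRow"

fun flip_arc :: "letter \<Rightarrow> letter" where
  "flip_arc (ArcUp i) = ArcDown i"
| "flip_arc (ArcDown i) = ArcUp i"
| "flip_arc l = l"

definition colours :: "nat \<Rightarrow> nat \<Rightarrow> letter set" where
  "colours m n = EdgeCol ` {1..m} \<union> ArcUp ` {1..n} \<union> ArcDown ` {1..n}"

lemma graph_alphabet_colours: "graph_alphabet m n - {EndRow} = insert NotAdj (colours m n)"
  by (auto simp: graph_alphabet_def colours_def)

lemma finite_graph_alphabet: "finite (graph_alphabet m n)"
  by (simp add: graph_alphabet_def)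

lemma finite_colours: "finite (colours m n)"
  by (simp add: colours_def)

text \<open>The generated monoid, since two successive switches at a vertex need not act like a
  single element of \<Gamma>: the second one looks up the orientation under the colour already
  changed.\<close>

inductive_set switch_maps :: "switch set \<Rightarrow> (letter \<Rightarrow> letter) set" for \<Gamma> where
  id_switch_maps: "id \<in> switch_maps \<Gamma>"
| act_switch_maps: "\<pi> \<in> \<Gamma> \<Longrightarrow> t \<in> switch_maps \<Gamma> \<Longrightarrow> act \<pi> \<circ> t \<in> switch_maps \<Gamma>"

lemma comp_switch_maps: "s \<in> switch_maps \<Gamma> \<Longrightarrow> t \<in> switch_maps \<Gamma> \<Longrightarrow> s \<circ> t \<in> switch_maps \<Gamma>"
  by (induction rule: switch_maps.induct) (auto simp: comp_assoc intro: switch_maps.intros)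

lemma funpow_switch_maps: "t \<in> switch_maps \<Gamma> \<Longrightarrow> t ^^ k \<in> switch_maps \<Gamma>"
  by (induction k) (auto simp: id_def[symmetric] intro: comp_switch_maps id_switch_maps)

lemma carrier_switch_groupD:
  assumes "(\<alpha>, \<beta>, \<gamma>) \<in> carrier (switch_group m n)"
  shows "\<alpha> permutes {1..m}" "\<beta> permutes {1..n}"
  using assms by (auto simp: switch_group_def sym_group_def)

lemma act_flip_arc: "act \<pi> (flip_arc l) = flip_arc (act \<pi> l)"
  by (cases \<pi>; cases l) auto

lemma act_colours:
  assumes "\<pi> \<in> carrier (switch_group m n)"
  shows "act \<pi> ` colours m n \<subseteq> colours m n" "inj_on (act \<pi>) (colours m n)"
proof -
  obtain \<alpha> \<beta> \<gamma> where \<pi>: "\<pi> = (\<alpha>, \<beta>, \<gamma>)" by (cases \<pi>)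
  note p = carrier_switch_groupD[OF assms[unfolded \<pi>]]
  have "\<alpha> i \<in> {1..m} \<longleftrightarrow> i \<in> {1..m}" "\<beta> i \<in> {1..n} \<longleftrightarrow> i \<in> {1..n}" for i
    using permutes_in_image p by metis+
  then show "act \<pi> ` colours m n \<subseteq> colours m n"
    by (auto simp: colours_def \<pi>)
  have "\<alpha> i = \<alpha> j \<longleftrightarrow> i = j" "\<beta> i = \<beta> j \<longleftrightarrow> i = j" for i j
    using p by (simp_all add: permutes_inj inj_eq)
  then show "inj_on (act \<pi>) (colours m n)"
    unfolding inj_on_def colours_def \<pi> by (auto split: if_splits)
qed

lemma switch_maps_colours:
  assumes "t \<in> switch_maps \<Gamma>" "\<Gamma> \<subseteq> carrier (switch_group m n)"
  shows "t ` colours m n \<subseteq> colours m n \<and> inj_on t (colours m n) \<and> t NotAdj = NotAdj \<and>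
    (\<forall>l. t (flip_arc l) = flip_arc (t l))"
  using assms
proof (induction rule: switch_maps.induct)
  case (act_switch_maps \<pi> t)
  have \<pi>: "\<pi> \<in> carrier (switch_group m n)" using act_switch_maps by blast
  have t: "t ` colours m n \<subseteq> colours m n" "inj_on t (colours m n)" using act_switch_maps by auto
  have "inj_on (act \<pi> \<circ> t) (colours m n)"
    using t inj_on_subset[OF act_colours(2)[OF \<pi>]] by (intro comp_inj_on) auto
  moreover have "(act \<pi> \<circ> t) ` colours m n \<subseteq> colours m n"
    using t act_colours(1)[OF \<pi>] by auto
  ultimately show ?case using act_switch_maps by (simp add: act_flip_arc comp_def)
qed auto

text \<open>An inverse is obtained as a power, since the inverse of a tuple in \<open>switch_group\<close> need not
  act as the inverse: the orientation entries are not permuted along with the arc colours.\<close>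

lemma inverse_switch_maps:
  assumes "t \<in> switch_maps \<Gamma>" "\<Gamma> \<subseteq> carrier (switch_group m n)"
  shows "\<exists>t' \<in> switch_maps \<Gamma>. \<forall>y \<in> colours m n. t' (t y) = y \<and> t (t' y) = y"
proof -
  let ?X = "colours m n"
  have t: "t ` ?X \<subseteq> ?X" "inj_on t ?X" using switch_maps_colours[OF assms] by auto
  \<comment> \<open>\<open>t\<close> is controlled on \<open>?X\<close> only; extended by the
    identity it becomes a permutation of all letters with finite support, hence of finite
    order.\<close>
  define p where "p y = (if y \<in> ?X then t y else y)" for y
  have "bij_betw t ?X ?X"
    using endo_inj_surj[OF finite_colours t] t by (simp add: bij_betw_def)
  then have "p permutes ?X"
    by (intro bij_imp_permutes) (auto simp: p_def cong: bij_betw_cong)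
  then have "permutation p" using finite_colours permutation_permutes by blast
  then obtain k where k: "p ^^ k = id" "k > 0" using permutation_is_nilpotent by metis
  then obtain j where j: "k = Suc j" using gr0_implies_Suc by blast
  have pt: "(t ^^ i) y \<in> ?X \<and> (p ^^ i) y = (t ^^ i) y" if "y \<in> ?X" for i y
    using that t(1) by (induction i) (auto simp: p_def)
  have "(t ^^ j) (t y) = y \<and> t ((t ^^ j) y) = y" if "y \<in> ?X" for y
  proof -
    have "(t ^^ Suc j) y = y" using pt[OF that, of "Suc j"] k(1)[unfolded j] by (simp only: id_apply)
    then show ?thesis by (simp add: funpow_swap1)
  qed
  then show ?thesis using funpow_switch_maps[OF assms(1)] by blast
qed

lemma switching_switch_maps:
  assumes "\<Gamma> \<subseteq> carrier (switch_group m n)"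
  shows "switching (colours m n) (switch_maps \<Gamma>) NotAdj flip_arc"
proof
  show "id \<in> switch_maps \<Gamma>" by (rule id_switch_maps)
  show "s \<circ> t \<in> switch_maps \<Gamma>" if "s \<in> switch_maps \<Gamma>" "t \<in> switch_maps \<Gamma>" for s t
    using that by (rule comp_switch_maps)
  show "t y \<in> colours m n" if "t \<in> switch_maps \<Gamma>" "y \<in> colours m n" for t y
    using switch_maps_colours[OF that(1) assms] that(2) by blast
  show "\<exists>t' \<in> switch_maps \<Gamma>. \<forall>y \<in> colours m n. t' (t y) = y \<and> t (t' y) = y"
    if "t \<in> switch_maps \<Gamma>" for t using inverse_switch_maps[OF that assms] .
  show "NotAdj \<notin> colours m n" by (auto simp: colours_def)
  show "t NotAdj = NotAdj" if "t \<in> switch_maps \<Gamma>" for t using switch_maps_colours[OF that assms] by blast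
  show "flip_arc y \<in> colours m n" if "y \<in> colours m n" for y using that by (auto simp: colours_def)
  show "flip_arc (flip_arc y) = y" for y by (cases y) auto
  show "flip_arc NotAdj = NotAdj" by simp
  show "t (flip_arc y) = flip_arc (t y)" if "t \<in> switch_maps \<Gamma>" for t y
    using switch_maps_colours[OF that assms] by blast
qed

section \<open>Letters of pairs, homomorphisms and switches\<close>

lemma mixed_graphD:
  assumes "mixed_graph m n G"
  shows "finite (verts G)"
    "{u, v} \<in> edges G \<Longrightarrow> u \<in> verts G \<and> v \<in> verts G \<and> u \<noteq> v \<and> ecol G {u, v} \<in> {1..m}"
    "(u, v) \<in> arcs G \<Longrightarrow> u \<in> verts G \<and> v \<in> verts G \<and> u \<noteq> v \<and> acol G (u, v) \<in> {1..n}"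
    "(u, v) \<in> arcs G \<Longrightarrow> {u, v} \<notin> edges G \<and> {v, u} \<notin> edges G \<and> (v, u) \<notin> arcs G"
proof -
  show "finite (verts G)" using assms by (simp add: mixed_graph_def)
  have "edges G \<subseteq> {{u, v} | u v. u \<in> verts G \<and> v \<in> verts G \<and> u \<noteq> v}" "ecol G \<in> edges G \<rightarrow> {1..m}"
    using assms unfolding mixed_graph_def by blast+
  then show "{u, v} \<in> edges G \<Longrightarrow> u \<in> verts G \<and> v \<in> verts G \<and> u \<noteq> v \<and> ecol G {u, v} \<in> {1..m}"
    by (fastforce simp: doubleton_eq_iff)
  show "(u, v) \<in> arcs G \<Longrightarrow> u \<in> verts G \<and> v \<in> verts G \<and> u \<noteq> v \<and> acol G (u, v) \<in> {1..n}"
    using assms unfolding mixed_graph_def by blast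
  show "(u, v) \<in> arcs G \<Longrightarrow> {u, v} \<notin> edges G \<and> {v, u} \<notin> edges G \<and> (v, u) \<notin> arcs G"
    using assms unfolding mixed_graph_def by (metis insert_commute)
qed

lemma pair_letter_in_verts:
  assumes "mixed_graph m n G" "pair_letter G u v \<noteq> NotAdj"
  shows "u \<in> verts G" "v \<in> verts G" "u \<noteq> v"
  using assms mixed_graphD(2,3)[OF assms(1)] by (auto simp: pair_letter_def split: if_splits)

lemma pair_letter_eq_iff:
  assumes "mixed_graph m n G"
  shows "pair_letter G u v = EdgeCol c \<longleftrightarrow> {u, v} \<in> edges G \<and> ecol G {u, v} = c"
    "pair_letter G u v = ArcUp c \<longleftrightarrow> (u, v) \<in> arcs G \<and> acol G (u, v) = c"
    "pair_letter G u v = ArcDown c \<longleftrightarrow> (v, u) \<in> arcs G \<and> acol G (v, u) = c"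
  using mixed_graphD(4)[OF assms, of u v] mixed_graphD(4)[OF assms, of v u]
  by (auto simp: pair_letter_def)

lemma pair_letter_commute:
  assumes "mixed_graph m n G"
  shows "pair_letter G v u = flip_arc (pair_letter G u v)"
  using mixed_graphD(4)[OF assms, of u v] mixed_graphD(4)[OF assms, of v u]
  by (auto simp: pair_letter_def insert_commute)

lemma pair_letter_colours:
  assumes "mixed_graph m n G"
  shows "pair_letter G u v \<in> insert NotAdj (colours m n)"
  using mixed_graphD(2,3)[OF assms] unfolding pair_letter_def colours_def by auto

lemma mgraph_hom_iff_letters:
  assumes "mixed_graph m n G" "mixed_graph m n H"
  shows "mgraph_hom G H h \<longleftrightarrow> h ` verts G \<subseteq> verts H \<and>
    (\<forall>u v. pair_letter G u v \<noteq> NotAdj \<longrightarrow> pair_letter H (h u) (h v) = pair_letter G u v)"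
proof
  assume hom: "mgraph_hom G H h"
  have "pair_letter H (h u) (h v) = pair_letter G u v" if "pair_letter G u v \<noteq> NotAdj" for u v
  proof (cases "pair_letter G u v")
    case (EdgeCol c)
    then have "pair_letter H (h u) (h v) = EdgeCol c"
      using hom unfolding pair_letter_eq_iff[OF assms(1)] pair_letter_eq_iff[OF assms(2)] mgraph_hom_def by blast
    then show ?thesis using EdgeCol by simp
  next
    case (ArcUp c)
    then have "pair_letter H (h u) (h v) = ArcUp c"
      using hom unfolding pair_letter_eq_iff[OF assms(1)] pair_letter_eq_iff[OF assms(2)] mgraph_hom_def by blast
    then show ?thesis using ArcUp by simp
  next
    case (ArcDown c)
    then have "pair_letter H (h u) (h v) = ArcDown c"
      using hom unfolding pair_letter_eq_iff[OF assms(1)] pair_letter_eq_iff[OF assms(2)] mgraph_hom_def by blast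
    then show ?thesis using ArcDown by simp
  next
    case EndRow
    then show ?thesis by (auto simp: pair_letter_def split: if_splits)
  qed (use that in simp)
  then show "h ` verts G \<subseteq> verts H \<and>
    (\<forall>u v. pair_letter G u v \<noteq> NotAdj \<longrightarrow> pair_letter H (h u) (h v) = pair_letter G u v)"
    using hom unfolding mgraph_hom_def by auto
next
  assume h: "h ` verts G \<subseteq> verts H \<and>
    (\<forall>u v. pair_letter G u v \<noteq> NotAdj \<longrightarrow> pair_letter H (h u) (h v) = pair_letter G u v)"
  show "mgraph_hom G H h"
    unfolding mgraph_hom_def
  proof (intro conjI allI impI)
    show "h \<in> verts G \<rightarrow> verts H" using h by blast
    fix u v
    { assume "{u, v} \<in> edges G"
      then have "pair_letter G u v = EdgeCol (ecol G {u, v})" by (simp add: pair_letter_def)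
      then have "pair_letter H (h u) (h v) = EdgeCol (ecol G {u, v})" using h by simp
      then show "{h u, h v} \<in> edges H" "ecol H {h u, h v} = ecol G {u, v}"
        unfolding pair_letter_eq_iff[OF assms(2)] by auto }
    { assume "(u, v) \<in> arcs G"
      then have "pair_letter G u v = ArcUp (acol G (u, v))" using pair_letter_eq_iff[OF assms(1)] by simp
      then have "pair_letter H (h u) (h v) = ArcUp (acol G (u, v))" using h by simp
      then show "(h u, h v) \<in> arcs H" "acol H (h u, h v) = acol G (u, v)"
        unfolding pair_letter_eq_iff[OF assms(2)] by auto }
  qed
qed

lemma switch_at_simps:
  "verts (switch_at G (w, \<alpha>, \<beta>, \<gamma>)) = verts G"
  "edges (switch_at G (w, \<alpha>, \<beta>, \<gamma>)) = edges G"
  "arcs (switch_at G (w, \<alpha>, \<beta>, \<gamma>)) = switch_arc G w (\<alpha>, \<beta>, \<gamma>) ` arcs G"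
  "ecol (switch_at G (w, \<alpha>, \<beta>, \<gamma>)) e = (if w \<in> e then \<alpha> (ecol G e) else ecol G e)"
  by (simp_all add: switch_at_def)

lemma switch_arc_pair:
  "switch_arc G w (\<alpha>, \<beta>, \<gamma>) (u, v) =
    (if (w = u \<or> w = v) \<and> \<gamma> (acol G (u, v)) 1 \<noteq> 1 then (v, u) else (u, v))"
  by (auto simp: switch_arc_def incident_def orient_def)

text \<open>Only an arc and its opposite could get the same image, and a mixed graph never contains
  both.\<close>

lemma inj_on_switch_arc:
  assumes "mixed_graph m n G"
  shows "inj_on (switch_arc G w (\<alpha>, \<beta>, \<gamma>)) (arcs G)"
proof (rule inj_onI)
  fix a b assume ab: "a \<in> arcs G" "b \<in> arcs G" "switch_arc G w (\<alpha>, \<beta>, \<gamma>) a = switch_arc G w (\<alpha>, \<beta>, \<gamma>) b"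
  obtain u v x y where "a = (u, v)" "b = (x, y)" by (metis surj_pair)
  then show "a = b"
    using ab mixed_graphD(4)[OF assms, of u v] by (auto simp: switch_arc_pair split: if_splits)
qed

lemma acol_switch_at:
  assumes "mixed_graph m n G" "(u, v) \<in> arcs G"
  shows "acol (switch_at G (w, \<alpha>, \<beta>, \<gamma>)) (switch_arc G w (\<alpha>, \<beta>, \<gamma>) (u, v)) =
    (if w = u \<or> w = v then \<beta> (acol G (u, v)) else acol G (u, v))"
  by (simp add: switch_at_def the_inv_into_f_f[OF inj_on_switch_arc[OF assms(1)] assms(2)] incident_def)

lemma arcs_switch_at_iff:
  "(u, v) \<in> arcs (switch_at G (w, \<alpha>, \<beta>, \<gamma>)) \<longleftrightarrow>
    (u, v) \<in> arcs G \<and> switch_arc G w (\<alpha>, \<beta>, \<gamma>) (u, v) = (u, v) \<or>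
    (v, u) \<in> arcs G \<and> switch_arc G w (\<alpha>, \<beta>, \<gamma>) (v, u) = (u, v)"
proof
  assume "(u, v) \<in> arcs (switch_at G (w, \<alpha>, \<beta>, \<gamma>))"
  then obtain x y where "(x, y) \<in> arcs G" "(u, v) = switch_arc G w (\<alpha>, \<beta>, \<gamma>) (x, y)"
    by (auto simp: switch_at_simps)
  then show "(u, v) \<in> arcs G \<and> switch_arc G w (\<alpha>, \<beta>, \<gamma>) (u, v) = (u, v) \<or>
    (v, u) \<in> arcs G \<and> switch_arc G w (\<alpha>, \<beta>, \<gamma>) (v, u) = (u, v)"
    by (auto simp: switch_arc_pair split: if_splits)
next
  assume "(u, v) \<in> arcs G \<and> switch_arc G w (\<alpha>, \<beta>, \<gamma>) (u, v) = (u, v) \<or>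
    (v, u) \<in> arcs G \<and> switch_arc G w (\<alpha>, \<beta>, \<gamma>) (v, u) = (u, v)"
  then show "(u, v) \<in> arcs (switch_at G (w, \<alpha>, \<beta>, \<gamma>))"
    by (metis image_eqI switch_at_simps(3))
qed

lemma mixed_graph_switch_at:
  assumes G: "mixed_graph m n G" and \<pi>: "\<pi> \<in> carrier (switch_group m n)"
  shows "mixed_graph m n (switch_at G (w, \<pi>))"
proof -
  obtain \<alpha> \<beta> \<gamma> where \<pi>': "\<pi> = (\<alpha>, \<beta>, \<gamma>)" by (cases \<pi>)
  note p = carrier_switch_groupD[OF \<pi>[unfolded \<pi>']]
  let ?G = "switch_at G (w, \<alpha>, \<beta>, \<gamma>)" and ?f = "switch_arc G w (\<alpha>, \<beta>, \<gamma>)"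
  have arc: "(u, v) \<in> arcs ?G \<Longrightarrow> u \<in> verts G \<and> v \<in> verts G \<and> u \<noteq> v" for u v
    using mixed_graphD(3)[OF G, of u v] mixed_graphD(3)[OF G, of v u] by (auto simp: arcs_switch_at_iff)
  have opp: "{u, v} \<notin> edges G \<and> (v, u) \<notin> arcs ?G" if "(u, v) \<in> arcs ?G" for u v
    using that mixed_graphD(4)[OF G, of u v] mixed_graphD(4)[OF G, of v u] arc[OF that]
    unfolding arcs_switch_at_iff by auto
  have ec: "ecol ?G \<in> edges G \<rightarrow> {1..m}"
  proof
    fix e assume "e \<in> edges G"
    then have "ecol G e \<in> {1..m}" using G unfolding mixed_graph_def by blast
    then show "ecol ?G e \<in> {1..m}" using permutes_in_image[OF p(1)] by (simp add: switch_at_simps del: atLeastAtMost_iff)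
  qed
  have ac: "acol ?G \<in> arcs ?G \<rightarrow> {1..n}"
  proof
    fix b assume "b \<in> arcs ?G"
    then obtain u v where a: "(u, v) \<in> arcs G" "b = ?f (u, v)" by (auto simp: switch_at_simps)
    then have "acol G (u, v) \<in> {1..n}" using mixed_graphD(3)[OF G] by blast
    then show "acol ?G b \<in> {1..n}"
      using permutes_in_image[OF p(2)] by (simp add: a acol_switch_at[OF G a(1)] del: atLeastAtMost_iff)
  qed
  have "edges G \<subseteq> {{u, v} | u v. u \<in> verts G \<and> v \<in> verts G \<and> u \<noteq> v}" "finite (verts G)"
    using G unfolding mixed_graph_def by blast+
  then show ?thesis
    using arc opp ec ac unfolding mixed_graph_def \<pi>' switch_at_simps(1,2) by blast
qed

lemma pair_letter_switch_at:
  assumes G: "mixed_graph m n G"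
  shows "pair_letter (switch_at G (w, \<pi>)) u v =
    (if w = u \<or> w = v then act \<pi> (pair_letter G u v) else pair_letter G u v)"
proof -
  obtain \<alpha> \<beta> \<gamma> where \<pi>: "\<pi> = (\<alpha>, \<beta>, \<gamma>)" by (cases \<pi>)
  let ?G = "switch_at G (w, \<alpha>, \<beta>, \<gamma>)"
  \<comment> \<open>Both reading orders are treated at once, so that the \<open>ArcDown\<close> case
    follows by exchanging \<open>u\<close> and \<open>v\<close>.\<close>
  have arc: "pair_letter ?G u v = (if w = u \<or> w = v then act \<pi> (ArcUp c) else ArcUp c) \<and>
      pair_letter ?G v u = (if w = u \<or> w = v then act \<pi> (ArcDown c) else ArcDown c)"
    if a: "(u, v) \<in> arcs G" "acol G (u, v) = c" for u v c
  proof -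
    have e: "{u, v} \<notin> edges G" "{v, u} \<notin> edges G" "(v, u) \<notin> arcs G" "u \<noteq> v"
      using mixed_graphD(3,4)[OF G a(1)] by auto
    note c = acol_switch_at[OF G a(1), of w \<alpha> \<beta> \<gamma>, unfolded a(2)]
    show ?thesis
    proof (cases "(w = u \<or> w = v) \<and> \<gamma> c 1 \<noteq> 1")
      case True
      then have f: "switch_arc G w (\<alpha>, \<beta>, \<gamma>) (u, v) = (v, u)" by (simp add: switch_arc_pair a)
      then have "(v, u) \<in> arcs ?G" "(u, v) \<notin> arcs ?G" "acol ?G (v, u) = \<beta> c"
        using a e c True by (auto simp: arcs_switch_at_iff)
      then show ?thesis using True e by (simp add: pair_letter_def switch_at_simps(2) \<pi>)
    next
      case False
      then have f: "switch_arc G w (\<alpha>, \<beta>, \<gamma>) (u, v) = (u, v)" by (auto simp: switch_arc_pair a)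
      then have "(u, v) \<in> arcs ?G" "(v, u) \<notin> arcs ?G"
          "acol ?G (u, v) = (if w = u \<or> w = v then \<beta> c else c)"
        using a e c by (auto simp: arcs_switch_at_iff)
      then show ?thesis using False e by (auto simp: pair_letter_def switch_at_simps(2) \<pi>)
    qed
  qed
  consider c where "pair_letter G u v = EdgeCol c" | c where "pair_letter G u v = ArcUp c"
    | c where "pair_letter G u v = ArcDown c" | "pair_letter G u v = NotAdj"
    using pair_letter_colours[OF G, of u v] by (auto simp: colours_def)
  then show ?thesis
  proof cases
    case (1 c)
    then have "{u, v} \<in> edges G" "ecol G {u, v} = c" by (simp_all add: pair_letter_eq_iff[OF G])
    then show ?thesis
      by (simp add: pair_letter_def switch_at_simps \<pi>)
  next
    case (2 c)
    then have "(u, v) \<in> arcs G" "acol G (u, v) = c" by (simp_all add: pair_letter_eq_iff[OF G])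
    then show ?thesis using arc[of u v c] 2 unfolding \<pi> by simp
  next
    case (3 c)
    then have "(v, u) \<in> arcs G" "acol G (v, u) = c" by (simp_all add: pair_letter_eq_iff[OF G])
    then show ?thesis using arc[of v u c] 3 unfolding \<pi> by (simp add: disj_commute)
  next
    case 4
    then have "{u, v} \<notin> edges G" "(u, v) \<notin> arcs G" "(v, u) \<notin> arcs G"
      by (auto simp: pair_letter_def split: if_splits)
    then have "pair_letter ?G u v = NotAdj"
      by (simp add: pair_letter_def arcs_switch_at_iff switch_at_simps(2))
    then show ?thesis by (simp add: 4 \<pi>)
  qed
qed

section \<open>Switchable homomorphisms in terms of potentials\<close>

locale switch_action =
  fixes m n :: nat and \<Gamma> :: "switch set"
  assumes \<Gamma>: "\<Gamma> \<subseteq> carrier (switch_group m n)"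

sublocale switch_action \<subseteq> switching "colours m n" "switch_maps \<Gamma>" NotAdj flip_arc
  using \<Gamma> by (rule switching_switch_maps)

context switch_action
begin

lemma labelling_pair_letter:
  assumes "mixed_graph m n G"
  shows "labelling (pair_letter G)"
  unfolding labelling_def
proof (intro allI conjI)
  fix u v
  show "pair_letter G u v \<in> insert NotAdj (colours m n)" by (rule pair_letter_colours[OF assms])
  show "pair_letter G v u = flip_arc (pair_letter G u v)" by (rule pair_letter_commute[OF assms])
  show "pair_letter G u u = NotAdj" using pair_letter_in_verts(3)[OF assms, of u u] by blast
qed

lemma switch_pair_letter:
  "mixed_graph m n G \<Longrightarrow> pair_letter (switch_at G (w, \<pi>)) = switch w (act \<pi>) (pair_letter G)"
  by (intro ext) (simp add: switch_def pair_letter_switch_at)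

lemma switch_seq_snoc: "switch_seq G (\<Sigma> @ [p]) = switch_at (switch_seq G \<Sigma>) p"
  by (simp add: switch_seq_def)

lemma switch_seq_reach:
  assumes "mixed_graph m n G" "\<Sigma> \<in> lists (verts G \<times> \<Gamma>)"
  shows "mixed_graph m n (switch_seq G \<Sigma>) \<and> verts (switch_seq G \<Sigma>) = verts G \<and>
    reach (verts G) (pair_letter G) (pair_letter (switch_seq G \<Sigma>))"
  using assms(2)
proof (induction \<Sigma> rule: rev_induct)
  case Nil
  then show ?case using assms(1) reach_refl by (simp add: switch_seq_def)
next
  case (snoc p \<Sigma>)
  obtain w \<pi> where p: "p = (w, \<pi>)" by (cases p)
  let ?G = "switch_seq G \<Sigma>"
  have IH: "mixed_graph m n ?G" "verts ?G = verts G" "reach (verts G) (pair_letter G) (pair_letter ?G)"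
    and w: "w \<in> verts G" "\<pi> \<in> \<Gamma>"
    using snoc by (auto simp: p)
  have "act \<pi> \<in> switch_maps \<Gamma>" using act_switch_maps[OF w(2) id_switch_maps] by simp
  then have "reach (verts G) (pair_letter G) (switch w (act \<pi>) (pair_letter ?G))"
    using IH w by (intro reach_step)
  moreover have "verts (switch_at ?G (w, \<pi>)) = verts G"
    using IH(2) by (cases \<pi>) (simp add: switch_at_simps)
  moreover have "\<pi> \<in> carrier (switch_group m n)" using w(2) \<Gamma> by blast
  ultimately show ?case
    using mixed_graph_switch_at[OF IH(1), of \<pi> w] switch_pair_letter[OF IH(1), of w \<pi>]
    by (simp add: p switch_seq_snoc)
qed

text \<open>A member of \<open>switch_maps\<close> is a product of actions, hence several switches
  at the same vertex.\<close>

lemma reach_switch_seq: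
  assumes "reach (verts G) (pair_letter G) l" "mixed_graph m n G"
  shows "\<exists>\<Sigma> \<in> lists (verts G \<times> \<Gamma>). pair_letter (switch_seq G \<Sigma>) = l"
  using assms(1)
proof (induction rule: reach.induct)
  case reach_refl
  then show ?case by (intro bexI[of _ "[]"]) (simp_all add: switch_seq_def)
next
  case (reach_step l w t)
  from reach_step(3) show ?case
  proof (induction rule: switch_maps.induct)
    case id_switch_maps
    have "switch w id l = l" by (intro ext) (simp add: switch_def)
    then show ?case using reach_step(4) by (simp only:)
  next
    case (act_switch_maps \<pi> t)
    then obtain \<Sigma> where \<Sigma>: "\<Sigma> \<in> lists (verts G \<times> \<Gamma>)" "pair_letter (switch_seq G \<Sigma>) = switch w t l"
      by blast
    have "pair_letter (switch_seq G (\<Sigma> @ [(w, \<pi>)])) = switch w (act \<pi>) (switch w t l)"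
      using switch_pair_letter[of "switch_seq G \<Sigma>" w \<pi>] switch_seq_reach[OF assms(2) \<Sigma>(1)]
      by (simp add: switch_seq_snoc \<Sigma>(2))
    also have "\<dots> = switch w (act \<pi> \<circ> t) l" by (intro ext) (simp add: switch_def)
    finally show ?case
      by (rule bexI) (use \<Sigma>(1) act_switch_maps(1) reach_step(2) in auto)
  qed
qed

text \<open>The two-vertex target gives a potential on the switched \<open>H\<close>. Undoing the
  switches and rebasing yields one for \<open>x\<close>, and this is pulled back along
  homomorphisms. Conversely, a potential allows all letters of \<open>G\<close> to be switched to
  \<open>x\<close>, and then the two sides of the bipartition are mapped to \<open>a\<close> and
  \<open>b\<close>.\<close>

lemma switchable_hom_iff_potential:
  assumes H: "mixed_graph m n H" and col: "switchable_2_colourable m n \<Gamma> H"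
    and x: "pair_letter H a b \<noteq> NotAdj" and G: "mixed_graph m n G"
  shows "switchable_hom \<Gamma> G H \<longleftrightarrow> (\<exists>\<sigma> s. potential (verts G) (pair_letter G) (pair_letter H a b) \<sigma> s)"
proof -
  let ?x = "pair_letter H a b"
  note labH = labelling_pair_letter[OF H] and labG = labelling_pair_letter[OF G]
  have xX: "?x \<in> colours m n" using labellingD(1)[OF labH x] .
  have ab: "a \<in> verts H" "b \<in> verts H" using pair_letter_in_verts[OF H x] by auto
  have "\<exists>\<sigma> s. potential (verts H) (pair_letter H) ?x \<sigma> s"
  proof -
    obtain H' :: "nat mgraph" and \<Sigma> h where H': "mixed_graph m n H'" "card (verts H') = 2"
      "\<Sigma> \<in> lists (verts H \<times> \<Gamma>)" "mgraph_hom (switch_seq H \<Sigma>) H' h"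
      using col unfolding switchable_2_colourable_def switchable_hom_def by blast
    obtain p q where pq: "verts H' = {p, q}" "p \<noteq> q" using H'(2) by (auto simp: card_2_iff)
    let ?S = "switch_seq H \<Sigma>" and ?y = "pair_letter H' p q"
    have S: "mixed_graph m n ?S" "verts ?S = verts H" "reach (verts H) (pair_letter H) (pair_letter ?S)"
      using switch_seq_reach[OF H H'(3)] by auto
    note labH' = labelling_pair_letter[OF H'(1)]
    have h: "h ` verts H \<subseteq> {p, q}" "\<And>u v. pair_letter ?S u v \<noteq> NotAdj \<Longrightarrow> pair_letter H' (h u) (h v) = pair_letter ?S u v"
      using H'(4) unfolding mgraph_hom_iff_letters[OF S(1) H'(1)] by (auto simp: S(2) pq)
    have ne: "h u \<noteq> h v" if "pair_letter ?S u v \<noteq> NotAdj" for u v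
      using h(2)[OF that] that labellingD(3)[OF labH', of "h u"] by auto
    \<comment> \<open>The pair of \<open>a\<close> and \<open>b\<close> stays adjacent under
      switching, so the two vertices of \<open>H'\<close> are adjacent and their letter can serve as
      a reference.\<close>
    have Sab: "pair_letter ?S a b \<noteq> NotAdj" using reach_null[OF S(3) labH] x by simp
    have "h a \<in> {p, q}" "h b \<in> {p, q}" using h(1) ab by auto
    then have "(h a = p \<and> h b = q) \<or> (h a = q \<and> h b = p)" using ne[OF Sab] by auto
    then have "?y \<noteq> NotAdj"
      using h(2)[OF Sab] Sab labelling_null_commute[OF labH', of p q] by auto
    then have yX: "?y \<in> colours m n" using labellingD(1)[OF labH'] by blast
    have "potential (verts H) (pair_letter ?S) ?y (\<lambda>u. h u = p) (\<lambda>_. id)"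
      unfolding potential_def
    proof (intro conjI ballI impI)
      show "(\<lambda>_. id) ` verts H \<subseteq> switch_maps \<Gamma>" using id_switch_maps by blast
    next
      fix u v assume uv: "u \<in> verts H" "v \<in> verts H" "pair_letter ?S u v \<noteq> NotAdj"
      have huv: "h u \<in> {p, q}" "h v \<in> {p, q}" using h(1) uv by auto
      then show "(h u = p) \<noteq> (h v = p)" using ne[OF uv(3)] by auto
      assume "h u = p"
      then have "h v = q" using huv ne[OF uv(3)] by auto
      then show "eqv (pair_letter ?S u v) (id (id ?y))" using h(2)[OF uv(3)] \<open>h u = p\<close> by simp
    qed
    from potential_reach[OF S(3) labH yX this]
    show ?thesis using potential_rebase[OF labH yX _ ab x] by blast
  qed
  then obtain \<sigma> s where pot: "potential (verts H) (pair_letter H) ?x \<sigma> s" by blast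
  show ?thesis
  proof
    assume "switchable_hom \<Gamma> G H"
    then obtain \<Sigma> h where \<Sigma>: "\<Sigma> \<in> lists (verts G \<times> \<Gamma>)" "mgraph_hom (switch_seq G \<Sigma>) H h"
      unfolding switchable_hom_def by blast
    let ?S = "switch_seq G \<Sigma>"
    have S: "mixed_graph m n ?S" "verts ?S = verts G" "reach (verts G) (pair_letter G) (pair_letter ?S)"
      using switch_seq_reach[OF G \<Sigma>(1)] by auto
    have "potential (verts G) (pair_letter ?S) ?x (\<sigma> \<circ> h) (s \<circ> h)"
      using \<Sigma>(2)[unfolded mgraph_hom_iff_letters[OF S(1) H] S(2)]
      by (intro potential_pullback[OF pot]) simp_all
    then show "\<exists>\<sigma> s. potential (verts G) (pair_letter G) ?x \<sigma> s"
      using potential_reach[OF S(3) labG xX] by blast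
  next
    assume "\<exists>\<sigma> s. potential (verts G) (pair_letter G) ?x \<sigma> s"
    then obtain \<sigma> s where "potential (verts G) (pair_letter G) ?x \<sigma> s" by blast
    from reach_constant[OF mixed_graphD(1)[OF G] labG xX this] obtain l where
      l: "reach (verts G) (pair_letter G) l"
        "\<And>u v. u \<in> verts G \<Longrightarrow> v \<in> verts G \<Longrightarrow> l u v \<noteq> NotAdj \<Longrightarrow> \<sigma> u \<noteq> \<sigma> v \<and> (\<sigma> u \<longrightarrow> l u v = ?x)"
      by blast
    obtain \<Sigma> where \<Sigma>: "\<Sigma> \<in> lists (verts G \<times> \<Gamma>)" "pair_letter (switch_seq G \<Sigma>) = l"
      using reach_switch_seq[OF l(1) G] by blast
    let ?S = "switch_seq G \<Sigma>" and ?h = "\<lambda>u. if \<sigma> u then a else b"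
    have S: "mixed_graph m n ?S" "verts ?S = verts G" using switch_seq_reach[OF G \<Sigma>(1)] by auto
    have "pair_letter H (?h u) (?h v) = l u v" if uv: "l u v \<noteq> NotAdj" for u v
    proof -
      have V: "u \<in> verts G" "v \<in> verts G" using pair_letter_in_verts[OF S(1)] uv \<Sigma>(2) S(2) by auto
      have vu: "l v u \<noteq> NotAdj" "l u v = flip_arc (l v u)"
        using labelling_null_commute labellingD(2) labelling_pair_letter[OF S(1)] uv \<Sigma>(2) by metis+
      show ?thesis
      proof (cases "\<sigma> u")
        case True
        then show ?thesis using l(2)[OF V uv] by simp
      next
        case False
        then have "\<sigma> v" "l v u = ?x" using l(2)[OF V uv] l(2)[OF V(2,1) vu(1)] by auto
        then show ?thesis using False vu(2) pair_letter_commute[OF H, of b a] by simp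
      qed
    qed
    then have "mgraph_hom ?S H ?h"
      unfolding mgraph_hom_iff_letters[OF S(1) H] \<Sigma>(2) using ab by auto
    then show "switchable_hom \<Gamma> G H" using \<Sigma>(1) unfolding switchable_hom_def by blast
  qed
qed

lemma switchable_hom_edgeless:
  assumes H: "mixed_graph m n H" and e: "\<And>a b. pair_letter H a b = NotAdj" and G: "mixed_graph m n G"
  shows "switchable_hom \<Gamma> G H \<longleftrightarrow> (verts G = {} \<or> verts H \<noteq> {}) \<and> (\<forall>u v. pair_letter G u v = NotAdj)"
proof
  assume "switchable_hom \<Gamma> G H"
  then obtain \<Sigma> h where \<Sigma>: "\<Sigma> \<in> lists (verts G \<times> \<Gamma>)" "mgraph_hom (switch_seq G \<Sigma>) H h"
    unfolding switchable_hom_def by blast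
  let ?S = "switch_seq G \<Sigma>"
  have S: "mixed_graph m n ?S" "verts ?S = verts G" "reach (verts G) (pair_letter G) (pair_letter ?S)"
    using switch_seq_reach[OF G \<Sigma>(1)] by auto
  have h: "h ` verts G \<subseteq> verts H" "pair_letter ?S u v = NotAdj" for u v
    using \<Sigma>(2) e unfolding mgraph_hom_iff_letters[OF S(1) H] S(2) by auto
  then show "(verts G = {} \<or> verts H \<noteq> {}) \<and> (\<forall>u v. pair_letter G u v = NotAdj)"
    using reach_null[OF S(3) labelling_pair_letter[OF G]] by auto
next
  assume *: "(verts G = {} \<or> verts H \<noteq> {}) \<and> (\<forall>u v. pair_letter G u v = NotAdj)"
  then have "(\<lambda>_. SOME y. y \<in> verts H) ` verts G \<subseteq> verts H" by (auto simp: some_in_eq)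
  then have "mgraph_hom (switch_seq G []) H (\<lambda>_. SOME y. y \<in> verts H)"
    using * by (simp add: switch_seq_def mgraph_hom_iff_letters[OF G H])
  then show "switchable_hom \<Gamma> G H" unfolding switchable_hom_def by blast
qed

end

section \<open>Encodings\<close>

text \<open>The order of vertices and of row entries is that of the encoding read from the
  right.\<close>

fun matrix_rows :: "(nat \<Rightarrow> nat \<Rightarrow> letter) \<Rightarrow> nat \<Rightarrow> (letter \<times> letter list) list" where
  "matrix_rows a 0 = []"
| "matrix_rows a (Suc N) = (EndRow, rev (map (\<lambda>u. a u N) [0..<N])) # matrix_rows a N"

lemma matrix_rows_cong: "(\<And>u v. v < N \<Longrightarrow> u < v \<Longrightarrow> a u v = b u v) \<Longrightarrow> matrix_rows a N = matrix_rows b N"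
  by (induction N) auto

lemma rev_encode:
  "rev (concat (map (\<lambda>v. map (\<lambda>u. a u v) [0..<v] @ [EndRow]) [0..<N])) = flat (matrix_rows a N)"
  by (induction N) auto

lemma encode_graph_eq: "rev (encode_graph G) = flat (matrix_rows (pair_letter G) (card (verts G)))"
  unfolding encode_graph_def adj_letter_eq by (rule rev_encode)

lemma matrix_rows_lists:
  "(\<And>u v. v < N \<Longrightarrow> u < v \<Longrightarrow> a u v \<in> B) \<Longrightarrow> matrix_rows a N \<in> lists ({EndRow} \<times> lists B)"
  by (induction N) auto

lemma sat_matrix_rows:
  "sat (\<lambda>_. D) R (matrix_rows a N) (rev (map \<phi> [0..<N])) \<longleftrightarrow>
    \<phi> ` {..<N} \<subseteq> D \<and> (\<forall>v<N. \<forall>u<v. (\<phi> u, \<phi> v) \<in> R (a u v))"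
  by (induction N) (auto simp: list_all2_rev list.rel_map list_all2_same lessThan_Suc less_Suc_eq)

lemma length_matrix_rows: "length (matrix_rows a N) = N"
  by (induction N) auto

lemma ex_sat_matrix_rows:
  "(\<exists>ds. sat (\<lambda>_. D) R (matrix_rows a N) ds) \<longleftrightarrow>
    (\<exists>\<phi>. \<phi> ` {..<N} \<subseteq> D \<and> (\<forall>v<N. \<forall>u<v. (\<phi> u, \<phi> v) \<in> R (a u v)))"
proof
  assume "\<exists>ds. sat (\<lambda>_. D) R (matrix_rows a N) ds"
  then obtain ds where ds: "sat (\<lambda>_. D) R (matrix_rows a N) ds" ..
  have "length (rev ds) = N" using sat_length[OF ds] by (simp add: length_matrix_rows)
  then have "ds = rev (map ((!) (rev ds)) [0..<N])" by (metis map_nth rev_rev_ident)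
  then show "\<exists>\<phi>. \<phi> ` {..<N} \<subseteq> D \<and> (\<forall>v<N. \<forall>u<v. (\<phi> u, \<phi> v) \<in> R (a u v))"
    using ds sat_matrix_rows[of D R a N "(!) (rev ds)"] by auto
next
  assume "\<exists>\<phi>. \<phi> ` {..<N} \<subseteq> D \<and> (\<forall>v<N. \<forall>u<v. (\<phi> u, \<phi> v) \<in> R (a u v))"
  then obtain \<phi> where "sat (\<lambda>_. D) R (matrix_rows a N) (rev (map \<phi> [0..<N]))"
    unfolding sat_matrix_rows ..
  then show "\<exists>ds. sat (\<lambda>_. D) R (matrix_rows a N) ds" ..
qed

text \<open>The length conditions hidden in \<open>sat\<close> turn a satisfiable list of rows into
  a triangular matrix.\<close>

lemma rows_matrix:
  assumes "rows \<in> lists ({EndRow} \<times> lists B)" "sat du R rows ds"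
  shows "\<exists>a. rows = matrix_rows a (length rows) \<and> (\<forall>v<length rows. \<forall>u<v. a u v \<in> B)"
  using assms
proof (induction rows arbitrary: ds rule: list.induct)
  case (Cons row rows)
  obtain xs where row: "row = (EndRow, xs)" "set xs \<subseteq> B"
  proof -
    from Cons.prems(1) have "row \<in> {EndRow} \<times> lists B" by simp
    then show ?thesis using that by (cases row) auto
  qed
  obtain d ds' where ds: "ds = d # ds'" using Cons.prems(2) by (cases ds) (auto simp: row)
  let ?N = "length rows"
  have len: "length xs = ?N" and s: "sat du R rows ds'"
    using Cons.prems(2) sat_length[of du R rows ds'] by (auto simp: row ds dest: list_all2_lengthD)
  obtain a where a: "rows = matrix_rows a ?N" "\<forall>v<?N. \<forall>u<v. a u v \<in> B"
    using Cons.IH[OF _ s] Cons.prems(1) by auto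
  let ?a = "\<lambda>u v. if v = ?N then rev xs ! u else a u v"
  have "map (\<lambda>u. ?a u ?N) [0..<?N] = rev xs" using map_nth[of "rev xs"] len by simp
  moreover have "matrix_rows ?a ?N = rows" using matrix_rows_cong[of ?N ?a a] a(1) by simp
  ultimately have "row # rows = matrix_rows ?a (length (row # rows))" by (simp add: row(1))
  moreover have "?a u v \<in> B" if "v < length (row # rows)" "u < v" for u v
    using that a(2) len row(2) nth_mem[of u "rev xs"] by (cases "v = ?N") auto
  ultimately show ?case by blast
qed simp

text \<open>Hence every triangular word over the alphabet encodes a graph, and the language needs no
  further test of well-formedness.\<close>

lemma ex_graph:
  fixes a :: "nat \<Rightarrow> nat \<Rightarrow> letter"
  assumes "\<forall>v<N. \<forall>u<v. a u v \<in> insert NotAdj (colours m n)"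
  shows "\<exists>G. mixed_graph m n G \<and> verts G = {..<N} \<and> (\<forall>v<N. \<forall>u<v. pair_letter G u v = a u v)"
proof -
  note a = assms[rule_format]
  define G :: "nat mgraph" where "G = \<lparr> verts = {..<N},
    edges = {{u, v} | u v. u < v \<and> v < N \<and> a u v \<in> range EdgeCol},
    arcs = {(u, v). u < v \<and> v < N \<and> a u v \<in> range ArcUp} \<union> {(v, u). u < v \<and> v < N \<and> a u v \<in> range ArcDown},
    ecol = (\<lambda>e. case a (Min e) (Max e) of EdgeCol i \<Rightarrow> i | _ \<Rightarrow> 0),
    acol = (\<lambda>(u, v). if u < v then (case a u v of ArcUp i \<Rightarrow> i | _ \<Rightarrow> 0)
                             else (case a v u of ArcDown i \<Rightarrow> i | _ \<Rightarrow> 0)) \<rparr>"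
  have e: "{u, v} \<in> edges G \<longleftrightarrow> v < N \<and> a u v \<in> range EdgeCol" if "u < v" for u v
    using that by (auto simp: G_def doubleton_eq_iff)
  have ar: "(u, v) \<in> arcs G \<longleftrightarrow> v < N \<and> a u v \<in> range ArcUp" "(v, u) \<in> arcs G \<longleftrightarrow> v < N \<and> a u v \<in> range ArcDown"
    if "u < v" for u v using that by (auto simp: G_def)
  have ec: "ecol G {u, v} = (case a u v of EdgeCol i \<Rightarrow> i | _ \<Rightarrow> 0)" if "u < v" for u v
    using that by (simp add: G_def)
  have ac: "acol G (u, v) = (case a u v of ArcUp i \<Rightarrow> i | _ \<Rightarrow> 0)"
      "acol G (v, u) = (case a u v of ArcDown i \<Rightarrow> i | _ \<Rightarrow> 0)" if "u < v" for u v
    using that by (simp_all add: G_def)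
  have "mixed_graph m n G"
    unfolding mixed_graph_def
  proof (intro conjI allI impI)
    show "finite (verts G)" by (simp add: G_def)
    show "edges G \<subseteq> {{u, v} | u v. u \<in> verts G \<and> v \<in> verts G \<and> u \<noteq> v}"
      by (fastforce simp: G_def)
    show "arcs G \<subseteq> {(u, v). u \<in> verts G \<and> v \<in> verts G \<and> u \<noteq> v}"
      by (auto simp: G_def)
    show "{u, v} \<notin> edges G" "(v, u) \<notin> arcs G" if "(u, v) \<in> arcs G" for u v
    proof -
      have "u < v \<or> v < u" using that by (auto simp: G_def)
      then show "{u, v} \<notin> edges G" "(v, u) \<notin> arcs G"
        using that e[of u v] e[of v u] ar[of u v] ar[of v u] by (auto simp: insert_commute)
    qed
    show "ecol G \<in> edges G \<rightarrow> {1..m}"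
    proof
      fix x assume "x \<in> edges G"
      then obtain u v where uv: "x = {u, v}" "u < v" "v < N" "a u v \<in> range EdgeCol" by (auto simp: G_def)
      then show "ecol G x \<in> {1..m}" using a[OF uv(3,2)] ec[OF uv(2)] by (auto simp: colours_def)
    qed
    show "acol G \<in> arcs G \<rightarrow> {1..n}"
    proof
      fix x assume "x \<in> arcs G"
      then consider u v where "x = (u, v)" "u < v" "v < N" "a u v \<in> range ArcUp"
        | u v where "x = (v, u)" "u < v" "v < N" "a u v \<in> range ArcDown" by (auto simp: G_def)
      then show "acol G x \<in> {1..n}"
      proof cases
        case (1 u v)
        then show ?thesis using a[OF 1(3,2)] ac[OF 1(2)] by (auto simp: colours_def)
      next
        case (2 u v)
        then show ?thesis using a[OF 2(3,2)] ac[OF 2(2)] by (auto simp: colours_def)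
      qed
    qed
  qed
  moreover have "pair_letter G u v = a u v" if "v < N" "u < v" for u v
    using a[OF that] that e[OF that(2)] ar[OF that(2)] ec[OF that(2)] ac[OF that(2)]
    by (auto simp: pair_letter_def colours_def)
  ultimately show ?thesis by (auto simp: G_def intro!: exI[of _ G])
qed

lemma switchable_hom_problem_eq:
  assumes "\<And>G :: nat mgraph. mixed_graph m n G \<Longrightarrow> switchable_hom \<Gamma> G H \<longleftrightarrow>
    (\<exists>\<phi>. \<phi> ` verts G \<subseteq> D \<and> (\<forall>u \<in> verts G. \<forall>v \<in> verts G. u < v \<longrightarrow> (\<phi> u, \<phi> v) \<in> R (pair_letter G u v)))"
  shows "switchable_hom_problem m n \<Gamma> H = {w. \<exists>rows ds.
    rows \<in> lists ({EndRow} \<times> lists (graph_alphabet m n - {EndRow})) \<and> rev w = flat rows \<and> sat (\<lambda>_. D) R rows ds}"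
    (is "_ = ?L")
proof -
  have sat_iff: "switchable_hom \<Gamma> G H \<longleftrightarrow> (\<exists>ds. sat (\<lambda>_. D) R (matrix_rows (pair_letter G) N) ds)"
    if G: "mixed_graph m n G" "verts G = {..<N}" for G :: "nat mgraph" and N
  proof -
    have "(\<forall>u \<in> {..<N}. \<forall>v \<in> {..<N}. u < v \<longrightarrow> P u v) \<longleftrightarrow> (\<forall>v<N. \<forall>u<v. P u v)" for P
      by (auto dest: less_trans)
    then show ?thesis unfolding assms[OF G(1)] ex_sat_matrix_rows G(2) by (simp only:)
  qed
  show ?thesis
  proof (intro equalityI subsetI)
    fix w assume "w \<in> switchable_hom_problem m n \<Gamma> H"
    then obtain G where G: "w = encode_graph G" "mixed_graph m n G" "verts G = {..<card (verts G)}" "switchable_hom \<Gamma> G H"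
      unfolding switchable_hom_problem_def by blast
    let ?rows = "matrix_rows (pair_letter G) (card (verts G))"
    have "?rows \<in> lists ({EndRow} \<times> lists (graph_alphabet m n - {EndRow}))"
      unfolding graph_alphabet_colours using pair_letter_colours[OF G(2)] by (rule matrix_rows_lists)
    moreover have "rev w = flat ?rows" unfolding G(1) by (rule encode_graph_eq)
    ultimately show "w \<in> ?L" using sat_iff[OF G(2,3)] G(4) by blast
  next
    fix w assume "w \<in> ?L"
    then obtain rows ds where r: "rows \<in> lists ({EndRow} \<times> lists (graph_alphabet m n - {EndRow}))"
      "rev w = flat rows" "sat (\<lambda>_. D) R rows ds" by blast
    obtain a where a: "rows = matrix_rows a (length rows)"
      "\<forall>v<length rows. \<forall>u<v. a u v \<in> insert NotAdj (colours m n)"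
      using rows_matrix[OF r(1,3)] unfolding graph_alphabet_colours by blast
    let ?N = "length rows"
    from ex_graph[OF a(2)] obtain G :: "nat mgraph" where G: "mixed_graph m n G" "verts G = {..<?N}"
      "\<forall>v<?N. \<forall>u<v. pair_letter G u v = a u v" by blast
    have rows: "rows = matrix_rows (pair_letter G) ?N"
      using matrix_rows_cong[of ?N "pair_letter G" a] G(3) a(1) by simp
    have "rev w = rev (encode_graph G)"
      using r(2) rows by (simp add: encode_graph_eq G(2))
    then have "w = encode_graph G" by simp
    moreover have "switchable_hom \<Gamma> G H" using sat_iff[OF G(1,2)] r(3) rows by auto
    ultimately show "w \<in> switchable_hom_problem m n \<Gamma> H"
      unfolding switchable_hom_problem_def using G(1,2) by auto
  qed
qed

theorem theorem1p4:
  fixes m n :: nat and \<Gamma> :: "switch set" and H :: "'w mgraph"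
  assumes "subgroup \<Gamma> (switch_group m n)"
    and "mixed_graph m n H"
    and "switchable_2_colourable m n \<Gamma> H"
  shows "polynomial_time (graph_alphabet m n) (switchable_hom_problem m n \<Gamma> H)"
proof -
  interpret switch_action m n \<Gamma>
    using assms(1) by unfold_locales (rule subgroup.subset)
  \<comment> \<open>Both cases below only have to provide a finite domain, constraints of the
    admissible form and the equivalence with solvability.\<close>
  have csp: ?thesis
    if fin: "finite D" and R: "\<And>l. l \<in> insert NotAdj (colours m n) \<Longrightarrow> R l \<subseteq> D \<times> D \<and> (R l = D \<times> D \<or> partial_bij (R l))"
      and hom: "\<And>G :: nat mgraph. mixed_graph m n G \<Longrightarrow> switchable_hom \<Gamma> G H \<longleftrightarrow>
        (\<exists>\<phi>. \<phi> ` verts G \<subseteq> D \<and> (\<forall>u \<in> verts G. \<forall>v \<in> verts G. u < v \<longrightarrow> (\<phi> u, \<phi> v) \<in> R (pair_letter G u v)))"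
    for D :: "(bool \<times> letter set) set" and R
  proof -
    have eq: "switchable_hom_problem m n \<Gamma> H = {w. \<exists>rows ds.
        rows \<in> lists ({EndRow} \<times> lists (graph_alphabet m n - {EndRow})) \<and> rev w = flat rows \<and> sat (\<lambda>_. D) R rows ds}"
      by (rule switchable_hom_problem_eq) (rule hom)
    show ?thesis
      unfolding eq
    proof (rule polynomial_time_csp)
      show "EndRow \<in> graph_alphabet m n" by (simp add: graph_alphabet_def)
      show "R l \<subseteq> D \<times> D \<and> (R l = D \<times> D \<or> partial_bij (R l))" if "l \<in> graph_alphabet m n - {EndRow}" for l
        using that unfolding graph_alphabet_colours by (rule R)
    qed (use fin finite_graph_alphabet in auto)
  qed
  show ?thesis
  proof (cases "\<exists>a b. pair_letter H a b \<noteq> NotAdj")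
    case True
    then obtain a b where ab: "pair_letter H a b \<noteq> NotAdj" by blast
    let ?x = "pair_letter H a b"
    have x: "?x \<in> colours m n" using labellingD(1)[OF labelling_pair_letter[OF assms(2)] ab] .
    show ?thesis
    proof (rule csp[of "vals ?x" "constraint ?x"])
      show "finite (vals ?x)" using finite_vals[OF finite_colours x] .
      show "constraint ?x l \<subseteq> vals ?x \<times> vals ?x \<and> (constraint ?x l = vals ?x \<times> vals ?x \<or> partial_bij (constraint ?x l))"
        for l
        using constraint_subset[of ?x l] partial_bij_constraint[OF x, of l]
        by (cases "l = NotAdj") (simp_all add: constraint_def)
      show "switchable_hom \<Gamma> G H \<longleftrightarrow> (\<exists>\<phi>. \<phi> ` verts G \<subseteq> vals ?x \<and> (\<forall>u \<in> verts G. \<forall>v \<in> verts G.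
          u < v \<longrightarrow> (\<phi> u, \<phi> v) \<in> constraint ?x (pair_letter G u v)))"
        if "mixed_graph m n G" for G :: "nat mgraph"
        unfolding switchable_hom_iff_potential[OF assms(2,3) ab that]
        by (rule potential_iff_constraints[OF labelling_pair_letter[OF that] x])
    qed
  next
    case False
    then have e: "pair_letter H a b = NotAdj" for a b by blast
    \<comment> \<open>One value suffices if \<open>H\<close> has a vertex. The empty domain makes
      every nonempty \<open>G\<close> infeasible, and the empty relation forbids adjacent
      pairs.\<close>
    let ?D = "if verts H = {} then {} else {undefined :: bool \<times> letter set}"
    let ?R = "\<lambda>l. if l = NotAdj then ?D \<times> ?D else {}"
    show ?thesis
    proof (rule csp[of ?D ?R])
      show "finite ?D" by simp
      show "?R l \<subseteq> ?D \<times> ?D \<and> (?R l = ?D \<times> ?D \<or> partial_bij (?R l))" for l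
        by (simp add: partial_bij_def single_valued_def)
      show "switchable_hom \<Gamma> G H \<longleftrightarrow> (\<exists>\<phi>. \<phi> ` verts G \<subseteq> ?D \<and> (\<forall>u \<in> verts G. \<forall>v \<in> verts G.
          u < v \<longrightarrow> (\<phi> u, \<phi> v) \<in> ?R (pair_letter G u v)))"
        if G: "mixed_graph m n G" for G :: "nat mgraph"
        unfolding switchable_hom_edgeless[OF assms(2) e G]
      proof
        assume "(verts G = {} \<or> verts H \<noteq> {}) \<and> (\<forall>u v. pair_letter G u v = NotAdj)"
        then show "\<exists>\<phi>. \<phi> ` verts G \<subseteq> ?D \<and> (\<forall>u \<in> verts G. \<forall>v \<in> verts G. u < v \<longrightarrow> (\<phi> u, \<phi> v) \<in> ?R (pair_letter G u v))"
          by (intro exI[of _ "\<lambda>_. undefined"]) auto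
      next
        assume "\<exists>\<phi>. \<phi> ` verts G \<subseteq> ?D \<and> (\<forall>u \<in> verts G. \<forall>v \<in> verts G. u < v \<longrightarrow> (\<phi> u, \<phi> v) \<in> ?R (pair_letter G u v))"
        then obtain \<phi> where \<phi>: "\<phi> ` verts G \<subseteq> ?D"
          "\<And>u v. u \<in> verts G \<Longrightarrow> v \<in> verts G \<Longrightarrow> u < v \<Longrightarrow> (\<phi> u, \<phi> v) \<in> ?R (pair_letter G u v)" by blast
        have less: "pair_letter G u v = NotAdj" if "u < v" for u v
        proof (rule ccontr)
          assume uv: "pair_letter G u v \<noteq> NotAdj"
          then show False using \<phi>(2)[OF _ _ that] pair_letter_in_verts[OF G uv] by simp
        qed
        have "pair_letter G u v = NotAdj" for u v
          using less[of u v] less[of v u] pair_letter_in_verts(3)[OF G, of u v]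
            labelling_null_commute[OF labelling_pair_letter[OF G], of u v] by (metis neqE)
        then show "(verts G = {} \<or> verts H \<noteq> {}) \<and> (\<forall>u v. pair_letter G u v = NotAdj)"
          using \<phi>(1) by auto
      qed
    qed
  qed
qed

end
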